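(* Let $M^5\subset\mathbb{C}^4$ be a connected $5$-dimensional CR-generic submanifold belonging to the General Class $\mathsf{III}_2$, of smoothness $\mathcal{C}^\kappa$ with $\kappa\geqslant 4$, or $\mathcal{C}^\infty$, or $\mathcal{C}^\omega$, with its biholomorphically invariant $(1,0)$ CR bundle $T^{1,0}M\subset\mathbb{C}\otimes_{\mathbb{R}}TM$. For any choice of local vector field generator $\mathcal{L}$ of $T^{1,0}M$, the associated frame $$\big\{\mathcal{L},\ \overline{\mathcal{L}},\ \mathcal{T},\ \mathcal{S},\ \mathcal{R}\big\},\qquad \mathcal{T}:=\sqrt{-1}\,[\mathcal{L},\overline{\mathcal{L}}],\quad \mathcal{S}:=[\mathcal{L},\mathcal{T}],\quad \mathcal{R}:=[\mathcal{L},[\mathcal{L},\mathcal{T}]],$$ for the full complexified tangent bundle $\mathbb{C}\otimes_{\mathbb{R}}TM$ performs a reduction of the full $\mathsf{GL}_5(\mathbb{C})$-structure of $\mathbb{C}\otimes_{\mathbb{R}}TM$ to the subgroup of real dimension $18$ $$\mathsf{G}_{\mathsf{III}_2}^{\mathsf{initial}}:=\left\{\begin{pmatrix}\mathsf{a}&0&0&0&0\\0&\overline{\mathsf{a}}&0&0&0\\ \mathsf{b}&\overline{\mathsf{b}}&\mathsf{a}\overline{\mathsf{a}}&0&0\\ \mathsf{e}&\mathsf{d}&\mathsf{c}&\mathsf{a}\mathsf{a}\overline{\mathsf{a}}&0\\ \mathsf{k}&\mathsf{h}&\mathsf{g}&\mathsf{f}&\mathsf{a}\mathsf{a}\mathsf{a}\overline{\mathsf{a}}\end{pmatrix}:\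 \mathsf{a}\in\mathbb{C}\setminus\{0\},\ \mathsf{b},\mathsf{c},\mathsf{d},\mathsf{e},\mathsf{f},\mathsf{g},\mathsf{h},\mathsf{k}\in\mathbb{C}\right\}\subset\mathsf{GL}_5(\mathbb{C}).$$
   Context: A real submanifold $M\subset\mathbb{C}^n$ is CR-generic if $TM+J\,TM=T\mathbb{C}^n|_M$, $J$ being the complex structure. $T^{1,0}M\subset\mathbb{C}\otimes_{\mathbb{R}}TM$ is the bundle of $(1,0)$ vectors tangent to $M$ and $T^{0,1}M=\overline{T^{1,0}M}$. For CR-generic $M^5\subset\mathbb{C}^4$, $T^{1,0}M$ has complex rank $1$; a local generator $\mathcal{L}$ is a nowhere vanishing local section, taken of the natural smoothness of the bundle ($\mathcal{C}^{\kappa-1}$, resp. $\mathcal{C}^\infty$, $\mathcal{C}^\omega$). General Class $\mathsf{III}_2$ is one of the classes of the Merker–Pocchiola–Sabzevari classification of CR manifolds of dimension at most $5$. It consists of the $M^5\subset\mathbb{C}^4$ such that, for any local generator $\mathcal{L}$ of $T^{1,0}M$, at every point where $\mathcal{L}$ is defined: (i) the vectors $\mathcal{L},\overline{\mathcal{L}},[\mathcal{L},\overline{\mathcal{L}}],[\mathcal{L},[\mathcal{L},\overline{\mathcal{L}}]],[\overline{\mathcal{L}},[\mathcal{L},\overline{\mathcal{L}}]]$ have complex rank only $4$ (when this rank is $5$ everywhere, $M$ belongs instead to the class $\mathsf{III}_1$); and (ii) the vectors $\mathcal{L},\overline{\mathcal{L}},[\mathcal{L},\overline{\mathcal{L}}],[\mathcal{L},[\mathcal{L},\overline{\mathcal{L}}]],[\mathcal{L},[\mathcal{L},[\mathcal{L},\overline{\mathcal{L}}]]]$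 have complex rank $5$. In particular, if $M$ belongs to this class, then $\mathbb{C}\otimes_{\mathbb{R}}TM=T^{1,0}M+T^{0,1}M+[T^{1,0}M,T^{0,1}M]+[T^{1,0}M,[T^{1,0}M,T^{0,1}M]]+[T^{1,0}M,[T^{1,0}M,[T^{1,0}M,T^{0,1}M]]]$; this consequence makes the five associated fields a frame. "Performs a reduction of the full $\mathsf{GL}_5(\mathbb{C})$-structure to a subgroup $\mathsf{G}$" means: $\mathsf{G}$ is a closed subgroup of $\mathsf{GL}_5(\mathbb{C})$, and for any two local generators defined on a common open subset $V\subset M$, the two associated frames, written as column vectors, are related at each point of $V$ by left multiplication by a matrix belonging to $\mathsf{G}$ (with entries functions on $V$). *)

theory Defs
  imports "HOL-Analysis.Analysis" "HOL-Algebra.Group"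
begin

datatype smoothness = C_fin nat | C_infinity | C_omega

primrec Ck_on :: "nat \<Rightarrow> 'a::euclidean_space set \<Rightarrow> ('a \<Rightarrow> 'b::real_normed_vector) \<Rightarrow> bool" where
  "Ck_on 0 U f \<longleftrightarrow> continuous_on U f"
| "Ck_on (Suc k) U f \<longleftrightarrow> (\<forall>x\<in>U. f differentiable (at x)) \<and>
     (\<forall>v. Ck_on k U (\<lambda>x. frechet_derivative f (at x) v))"

text \<open>Around every point of \<open>U\<close>, \<open>f\<close> is the sum of a power series in the coordinates
  \<open>(x - p) \<bullet> b\<close>, \<open>b \<in> Basis\<close>; the multi-indices are the functions \<open>\<alpha> :: 'a \<Rightarrow> nat\<close> supported
  in \<open>Basis\<close>, and summation over them is unconditional.\<close>

definition power_series_on :: "'a::euclidean_space set \<Rightarrow> ('a \<Rightarrow> 'b::real_normed_vector) \<Rightarrow> bool" where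
  "power_series_on U f \<longleftrightarrow> (\<forall>p\<in>U. \<exists>r>0. \<exists>c :: ('a \<Rightarrow> nat) \<Rightarrow> 'b. ball p r \<subseteq> U \<and>
     (\<forall>x\<in>ball p r. ((\<lambda>\<alpha>. (\<Prod>b\<in>Basis. ((x - p) \<bullet> b) ^ \<alpha> b) *\<^sub>R c \<alpha>) has_sum f x)
        {\<alpha>. \<forall>b. b \<notin> Basis \<longrightarrow> \<alpha> b = 0}))"

text \<open>Used for open \<open>U\<close> only. Real-analytic means smooth and locally the sum of a convergent
  power series.\<close>

fun of_class :: "smoothness \<Rightarrow> 'a::euclidean_space set \<Rightarrow> ('a \<Rightarrow> 'b::real_normed_vector) \<Rightarrow> bool" where
  "of_class (C_fin k) U f \<longleftrightarrow> Ck_on k U f"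
| "of_class C_infinity U f \<longleftrightarrow> (\<forall>k. Ck_on k U f)"
| "of_class C_omega U f \<longleftrightarrow> (\<forall>k. Ck_on k U f) \<and> power_series_on U f"

text \<open>A map on a not necessarily open set, typically a piece of a submanifold, is of class \<open>s\<close>
  if it extends locally to a map of class \<open>s\<close> on an open set of the ambient space.\<close>

definition of_class_within :: "smoothness \<Rightarrow> 'a::euclidean_space set \<Rightarrow> ('a \<Rightarrow> 'b::real_normed_vector) \<Rightarrow> bool" where
  "of_class_within s A f \<longleftrightarrow> (\<forall>p\<in>A. \<exists>U g. open U \<and> p \<in> U \<and> of_class s U g \<and> (\<forall>x\<in>A \<inter> U. g x = f x))"

text \<open>The natural smoothness of tangent bundles of manifolds of the given class.\<close>

fun bundle_class :: "smoothness \<Rightarrow> smoothness" where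
  "bundle_class (C_fin k) = C_fin (k - 1)"
| "bundle_class C_infinity = C_infinity"
| "bundle_class C_omega = C_omega"

definition submanifold :: "smoothness \<Rightarrow> nat \<Rightarrow> 'a::euclidean_space set \<Rightarrow> bool" where
  "submanifold s d M \<longleftrightarrow> (\<forall>p\<in>M. \<exists>U W (\<Phi> :: 'a \<Rightarrow> 'a) \<Psi> S.
     open U \<and> p \<in> U \<and> open W \<and> homeomorphism U W \<Phi> \<Psi> \<and> of_class s U \<Phi> \<and> of_class s W \<Psi> \<and>
     subspace S \<and> dim S = d \<and> \<Phi> ` (M \<inter> U) = W \<inter> S)"

definition tangent_space :: "'a::real_normed_vector set \<Rightarrow> 'a \<Rightarrow> 'a set" where
  "tangent_space M p = {v. \<exists>\<gamma> e. 0 < e \<and> \<gamma> ` {-e<..<e} \<subseteq> M \<and> \<gamma> 0 = p \<and>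
     (\<gamma> has_vector_derivative v) (at (0::real))}"

text \<open>The pair \<open>(u, v)\<close> stands for \<open>u + \<surd>-1 v\<close> in the complexification of a real vector space.
  If the latter carries a complex structure of its own, as \<open>\<complex>\<^sup>4\<close> does, it is not to be
  confused with this \<open>\<surd>-1\<close>.\<close>

definition cscale :: "complex \<Rightarrow> 'a::real_vector \<times> 'a \<Rightarrow> 'a \<times> 'a" where
  "cscale c w = (Re c *\<^sub>R fst w - Im c *\<^sub>R snd w, Re c *\<^sub>R snd w + Im c *\<^sub>R fst w)"

definition cconj :: "'a::real_vector \<times> 'a \<Rightarrow> 'a \<times> 'a" where
  "cconj w = (fst w, - snd w)"

global_interpretation cvec: vector_space "cscale :: complex \<Rightarrow> 'a::real_vector \<times> 'a \<Rightarrow> 'a \<times> 'a"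
  by unfold_locales (auto simp: cscale_def algebra_simps)

definition ctangent_space :: "'a::real_normed_vector set \<Rightarrow> 'a \<Rightarrow> ('a \<times> 'a) set" where
  "ctangent_space M p = tangent_space M p \<times> tangent_space M p"

definition is_basis :: "('a::real_vector \<times> 'a) ^ 'n \<Rightarrow> ('a \<times> 'a) set \<Rightarrow> bool" where
  "is_basis F E \<longleftrightarrow> inj (($) F) \<and> cvec.independent (range (($) F)) \<and> cvec.span (range (($) F)) = E"

definition frame_mult :: "complex ^ 'n ^ 'n \<Rightarrow> ('a::real_vector \<times> 'a) ^ 'n \<Rightarrow> ('a \<times> 'a) ^ 'n" where
  "frame_mult g F = (\<chi> i. \<Sum>j\<in>UNIV. cscale (g $ i $ j) (F $ j))"

text \<open>Derivative of the complexified vector field \<open>Y\<close>, given on the relatively open subset \<open>V\<close> of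
  a submanifold, along a complexified vector \<open>w\<close> tangent at \<open>p\<close>. The Frechet derivative within
  \<open>V\<close> is only determined on the tangent space, and it is only used there.\<close>

definition cderiv :: "'a::real_normed_vector set \<Rightarrow> ('a \<Rightarrow> 'a \<times> 'a) \<Rightarrow> 'a \<Rightarrow> 'a \<times> 'a \<Rightarrow> 'a \<times> 'a" where
  "cderiv V Y p w = frechet_derivative Y (at p within V) (fst w)
     + cscale \<i> (frechet_derivative Y (at p within V) (snd w))"

definition lie_bracket :: "'a::real_normed_vector set \<Rightarrow> ('a \<Rightarrow> 'a \<times> 'a) \<Rightarrow> ('a \<Rightarrow> 'a \<times> 'a) \<Rightarrow> 'a \<Rightarrow> 'a \<times> 'a" where
  "lie_bracket V X Y = (\<lambda>p. cderiv V Y p (X p) - cderiv V X p (Y p))"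

text \<open>The complex structure \<open>J\<close> of \<open>\<complex>\<^sup>n\<close> is multiplication by \<open>\<i>\<close> in \<open>complex ^ 'n\<close>.\<close>

definition J :: "complex ^ 'n \<Rightarrow> complex ^ 'n" where
  "J u = \<i> *s u"

definition cr_generic :: "(complex ^ 'n) set \<Rightarrow> bool" where
  "cr_generic M \<longleftrightarrow> (\<forall>p\<in>M. {u + J v | u v. u \<in> tangent_space M p \<and> v \<in> tangent_space M p} = UNIV)"

definition T10 :: "(complex ^ 'n) set \<Rightarrow> complex ^ 'n \<Rightarrow> ((complex ^ 'n) \<times> (complex ^ 'n)) set" where
  "T10 M p = {w \<in> ctangent_space M p. map_prod J J w = cscale \<i> w}"

definition local_generator ::
  "smoothness \<Rightarrow> (complex ^ 'n) set \<Rightarrow> (complex ^ 'n) set \<Rightarrow> (complex ^ 'n \<Rightarrow> (complex ^ 'n) \<times> (complex ^ 'n)) \<Rightarrow> bool" where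
  "local_generator s M V L \<longleftrightarrow> openin (top_of_set M) V \<and> of_class_within (bundle_class s) V L \<and>
     (\<forall>p\<in>V. L p \<in> T10 M p \<and> L p \<noteq> 0)"

definition general_class_III2 :: "smoothness \<Rightarrow> (complex ^ 4) set \<Rightarrow> bool" where
  "general_class_III2 s M \<longleftrightarrow> (\<forall>V L. local_generator s M V L \<longrightarrow>
     (let Lb = (\<lambda>p. cconj (L p)); B = lie_bracket V L Lb in
      \<forall>p\<in>V.
        cvec.dim {L p, Lb p, B p, lie_bracket V L B p, lie_bracket V Lb B p} = 4 \<and>
        cvec.dim {L p, Lb p, B p, lie_bracket V L B p, lie_bracket V L (lie_bracket V L B) p} = 5))"

definition frame_III2 ::
  "(complex ^ 4) set \<Rightarrow> (complex ^ 4 \<Rightarrow> (complex ^ 4) \<times> (complex ^ 4)) \<Rightarrow> complex ^ 4 \<Rightarrow> ((complex ^ 4) \<times> (complex ^ 4)) ^ 5" where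
  "frame_III2 V L p =
     (let Lb = (\<lambda>q. cconj (L q));
          T = (\<lambda>q. cscale \<i> (lie_bracket V L Lb q));
          S = lie_bracket V L T;
          R = lie_bracket V L (lie_bracket V L T)
      in vector [L p, Lb p, T p, S p, R p])"

definition GL :: "(complex ^ 'n ^ 'n) monoid" where
  "GL = \<lparr>carrier = {A. invertible A}, mult = (**), one = mat 1\<rparr>"

definition performs_reduction ::
  "smoothness \<Rightarrow> (complex ^ 'm) set \<Rightarrow>
   ((complex ^ 'm) set \<Rightarrow> (complex ^ 'm \<Rightarrow> (complex ^ 'm) \<times> (complex ^ 'm)) \<Rightarrow> complex ^ 'm \<Rightarrow> ((complex ^ 'm) \<times> (complex ^ 'm)) ^ 'n) \<Rightarrow>
   (complex ^ 'n ^ 'n) set \<Rightarrow> bool" where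
  "performs_reduction s M frame G \<longleftrightarrow>
     subgroup G GL \<and> closedin (top_of_set (carrier GL)) G \<and>
     (\<forall>V L L'. local_generator s M V L \<and> local_generator s M V L' \<longrightarrow>
        (\<exists>g. \<forall>p\<in>V. g p \<in> G \<and> frame V L' p = frame_mult (g p) (frame V L p)))"

definition G_III2_initial :: "(complex ^ 5 ^ 5) set" where
  "G_III2_initial = {vector [
      vector [a, 0, 0, 0, 0],
      vector [0, cnj a, 0, 0, 0],
      vector [b, cnj b, a * cnj a, 0, 0],
      vector [e, d, c, a * a * cnj a, 0],
      vector [k, h, g, f, a * a * a * cnj a]] | a b c d e f g h k. a \<noteq> 0}"

end

theory Submission
  imports Defs
begin

text \<open>If \<open>L' = a L\<close> for two generators of the bundle of \<open>(1,0)\<close> vectors, then repeated use of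
  \<open>[a L, f X] = a f [L, X] + a L(f) X - f X(a) L\<close> shows that the frame of \<open>L'\<close> is a lower
  triangular combination of that of \<open>L\<close>; the third row has the shape \<open>(b, cnj b, a cnj a)\<close>
  because \<open>T\<close> is real. The bundle is a line bundle because a tangent space \<open>E\<close> with
  \<open>E + J E = \<complex>\<^sup>4\<close> and \<open>dim E = 5\<close> satisfies \<open>dim (E \<inter> J E) = 5 + 5 - 8 = 2\<close>. Brackets are computed with local extensions to open
  subsets of the ambient space; a derivative within \<open>V\<close> along a tangent vector does not depend on
  the extension, since it is a derivative along a curve in \<open>V\<close>.\<close>

section \<open>Functions of class \<open>C\<^sup>k\<close> on open sets\<close>

text \<open>The bound 4 on the smoothness pays for the brackets: a generator then has class 3,
  \<open>T\<close> class 2, \<open>S\<close> class 1, and \<open>R\<close> is merely continuous. The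
  factor \<open>a\<close> must have class 3 as well, because the coefficients of \<open>T'\<close>,
  \<open>S'\<close> and \<open>R'\<close> contain its first, second and third derivatives. Yet
  linear algebra yields \<open>a\<close> only point by point; its regularity is recovered afterwards
  by dividing a component of \<open>L'\<close> by one of \<open>L\<close>. The obstacle is that
  fields live on a set \<open>V\<close> without interior. A derivative within \<open>V\<close> is
  not unique there, and \<open>frechet_derivative\<close> is an arbitrary choice among the
  candidates. Each computation must therefore know that its direction is tangent, and iterated
  brackets make sense only if a bracket of tangent fields is tangent again; this is where the
  symmetry of second derivatives of a chart enters. That the five fields form a basis is a dimension
  count: the rank condition makes them independent, and the complexification of a real space of
  dimension 5 has complex dimension 5.\<close>

lemma Ck_on_cong:
  assumes "Ck_on k U f" "open U" "\<And>x. x \<in> U \<Longrightarrow> f x = g x"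
  shows "Ck_on k U g"
  using assms(1,3)
proof (induction k arbitrary: f g)
  case 0
  then show ?case using continuous_on_cong[of U U f g] by simp
next
  case (Suc k)
  have "frechet_derivative f (at x) = frechet_derivative g (at x)" if "x \<in> U" for x
    using Suc.prems that \<open>open U\<close>
    by (intro frechet_derivative_transform_within_open[of f x U g]) auto
  moreover have "g differentiable (at x)" if "x \<in> U" for x
    using Suc.prems that \<open>open U\<close>
    by (metis Ck_on.simps(2) differentiable_def has_derivative_transform_within_open)
  ultimately show ?case
    using Suc by simp (metis (no_types, lifting))
qed

text \<open>Works with an explicit derivative formula, so that the closure properties below can be
  proved by induction on the formula.\<close>

lemma Ck_on_SucI:
  assumes "\<And>x. x \<in> U \<Longrightarrow> (f has_derivative f' x) (at x)"
    and "\<And>v. Ck_on k U (\<lambda>x. f' x v)" and "open U"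
  shows "Ck_on (Suc k) U f"
  unfolding Ck_on.simps
proof (intro conjI ballI allI)
  have *: "frechet_derivative f (at x) = f' x" if "x \<in> U" for x
    using assms(1)[OF that] frechet_derivative_at by metis
  show "f differentiable at x" if "x \<in> U" for x
    using assms(1)[OF that] differentiable_def by blast
  show "Ck_on k U (\<lambda>x. frechet_derivative f (at x) v)" for v
    using * by (intro Ck_on_cong[OF assms(2)[of v] assms(3)]) auto
qed

lemma Ck_on_SucD:
  assumes "Ck_on (Suc k) U f"
  shows "x \<in> U \<Longrightarrow> (f has_derivative frechet_derivative f (at x)) (at x)"
    and "Ck_on k U (\<lambda>x. frechet_derivative f (at x) v)"
  using assms frechet_derivative_works by auto

lemma Ck_on_Suc_imp: "Ck_on (Suc k) U f \<Longrightarrow> Ck_on k U f"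
proof (induction k arbitrary: f)
  case 0
  then show ?case
    by (auto intro!: differentiable_imp_continuous_on simp: differentiable_on_def differentiable_at_withinI)
next
  case (Suc k)
  then show ?case by (metis Ck_on.simps(2))
qed

lemma Ck_on_mono: "Ck_on k U f \<Longrightarrow> l \<le> k \<Longrightarrow> Ck_on l U f"
  by (induction k) (auto simp del: Ck_on.simps(2) dest: Ck_on_Suc_imp simp: le_Suc_eq)

lemma Ck_on_subset: "Ck_on k U f \<Longrightarrow> W \<subseteq> U \<Longrightarrow> Ck_on k W f"
  by (induction k arbitrary: f) (auto intro: continuous_on_subset)

lemma Ck_on_const: "open U \<Longrightarrow> Ck_on k U (\<lambda>x. c)"
proof (induction k arbitrary: c)
  case (Suc k)
  show ?case by (rule Ck_on_SucI[where f' = "\<lambda>x v. 0"]) (use Suc in auto)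
qed auto

lemma Ck_on_bounded_linear:
  assumes "bounded_linear h" "open U"
  shows "Ck_on k U f \<Longrightarrow> Ck_on k U (\<lambda>x. h (f x))"
proof (induction k arbitrary: f)
  case 0
  then show ?case using assms by (simp add: bounded_linear.continuous_on)
next
  case (Suc k)
  show ?case
    by (rule Ck_on_SucI[where f' = "\<lambda>x v. h (frechet_derivative f (at x) v)"])
      (use Suc Ck_on_SucD[OF Suc.prems] assms in \<open>auto intro: bounded_linear.has_derivative\<close>)
qed

lemma Ck_on_id: "open U \<Longrightarrow> Ck_on k U (\<lambda>x. x)"
proof (cases k)
  case (Suc n)
  assume "open U"
  then show ?thesis
    unfolding Suc by (intro Ck_on_SucI[where f' = "\<lambda>x v. v"]) (auto intro: Ck_on_const)
qed auto

lemma Ck_on_add: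
  assumes "open U"
  shows "Ck_on k U f \<Longrightarrow> Ck_on k U g \<Longrightarrow> Ck_on k U (\<lambda>x. f x + g x)"
proof (induction k arbitrary: f g)
  case 0
  then show ?case by (simp add: continuous_on_add)
next
  case (Suc k)
  show ?case
    by (rule Ck_on_SucI[where f' = "\<lambda>x v. frechet_derivative f (at x) v + frechet_derivative g (at x) v"])
      (use Suc Ck_on_SucD[OF Suc.prems(1)] Ck_on_SucD[OF Suc.prems(2)] assms
        in \<open>auto intro: has_derivative_add\<close>)
qed

lemma Ck_on_sum:
  assumes "open U" "finite I" "\<And>i. i \<in> I \<Longrightarrow> Ck_on k U (f i)"
  shows "Ck_on k U (\<lambda>x. \<Sum>i\<in>I. f i x)"
  using assms(2,3)
  by (induction I) (auto intro: Ck_on_const Ck_on_add assms)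

lemma Ck_on_bilinear:
  assumes "bounded_bilinear h" "open U"
  shows "Ck_on k U f \<Longrightarrow> Ck_on k U g \<Longrightarrow> Ck_on k U (\<lambda>x. h (f x) (g x))"
proof (induction k arbitrary: f g)
  case 0
  then show ?case using assms by (simp add: bounded_bilinear.continuous_on)
next
  case (Suc k)
  show ?case
  proof (rule Ck_on_SucI[where f' = "\<lambda>x v. h (f x) (frechet_derivative g (at x) v) + h (frechet_derivative f (at x) v) (g x)"])
    fix v
    show "Ck_on k U (\<lambda>x. h (f x) (frechet_derivative g (at x) v) + h (frechet_derivative f (at x) v) (g x))"
      by (intro Ck_on_add Suc.IH assms Ck_on_Suc_imp[OF Suc.prems(1)] Ck_on_Suc_imp[OF Suc.prems(2)]
          Ck_on_SucD(2)[OF Suc.prems(1)] Ck_on_SucD(2)[OF Suc.prems(2)])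
  qed (use Ck_on_SucD(1)[OF Suc.prems(1)] Ck_on_SucD(1)[OF Suc.prems(2)] assms
        in \<open>auto intro: bounded_bilinear.FDERIV\<close>)
qed

lemma Ck_on_inverse:
  fixes f :: "'a::euclidean_space \<Rightarrow> 'b::real_normed_div_algebra"
  assumes "open U" "\<And>x. x \<in> U \<Longrightarrow> f x \<noteq> 0"
  shows "Ck_on k U f \<Longrightarrow> Ck_on k U (\<lambda>x. inverse (f x))"
proof (induction k)
  case 0
  then show ?case using assms by (simp add: continuous_on_inverse)
next
  case (Suc k)
  show ?case
  proof (rule Ck_on_SucI[where f' = "\<lambda>x v. - (inverse (f x) * frechet_derivative f (at x) v * inverse (f x))"])
    show "Ck_on k U (\<lambda>x. - (inverse (f x) * frechet_derivative f (at x) v * inverse (f x)))" for v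
      by (intro Ck_on_bounded_linear[OF bounded_linear_minus[OF bounded_linear_ident]]
          Ck_on_bilinear[OF bounded_bilinear_mult] Ck_on_SucD(2)[OF Suc.prems] Suc.IH
          Ck_on_Suc_imp[OF Suc.prems] assms)
  qed (use Ck_on_SucD(1)[OF Suc.prems] assms in \<open>auto intro: has_derivative_inverse\<close>)
qed

lemma frechet_derivative_coordinates:
  fixes g :: "'a::euclidean_space \<Rightarrow> 'b::real_normed_vector"
  assumes "g differentiable (at x)"
  shows "frechet_derivative g (at x) v = (\<Sum>b\<in>Basis. (v \<bullet> b) *\<^sub>R frechet_derivative g (at x) b)"
proof -
  interpret linear "frechet_derivative g (at x)"
    by (rule linear_frechet_derivative[OF assms])
  show ?thesis
    by (subst euclidean_representation[of v, symmetric]) (simp only: sum scale)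
qed

text \<open>\<open>Ck_on\<close> controls derivatives in constant directions only. A varying
  direction is expanded in the standard basis, whose coefficients are as smooth as
  \<open>X\<close>.\<close>

lemma Ck_on_derivative_along:
  fixes g :: "'a::euclidean_space \<Rightarrow> 'b::real_normed_vector"
  assumes "Ck_on (Suc k) U g" "Ck_on k U X" "open U"
  shows "Ck_on k U (\<lambda>x. frechet_derivative g (at x) (X x))"
proof (rule Ck_on_cong)
  show "Ck_on k U (\<lambda>x. \<Sum>b\<in>Basis. (X x \<bullet> b) *\<^sub>R frechet_derivative g (at x) b)"
    by (intro Ck_on_sum Ck_on_bilinear[OF bounded_bilinear_scaleR]
        Ck_on_bounded_linear[OF bounded_linear_inner_left] Ck_on_SucD(2)[OF assms(1)] assms) auto
  show "(\<Sum>b\<in>Basis. (X x \<bullet> b) *\<^sub>R frechet_derivative g (at x) b) = frechet_derivative g (at x) (X x)"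
    if "x \<in> U" for x
    using assms(1) that by (simp add: frechet_derivative_coordinates[of g x "X x", symmetric])
qed fact

section \<open>Symmetry of second derivatives\<close>

text \<open>By continuity \<open>c\<close> separates the two mixed derivatives on a whole ball. The
  second difference of \<open>f\<close> over a small parallelogram with sides
  \<open>h *\<^sub>R u\<close> and \<open>h *\<^sub>R v\<close> is, by two uses of the mean value
  theorem, \<open>h * h\<close> times a value of either mixed derivative, so it would lie on both
  sides of \<open>h * h * c\<close>.\<close>

lemma mixed_derivatives_separated:
  fixes f :: "'a::euclidean_space \<Rightarrow> real"
  assumes f: "Ck_on 2 U f" and U: "open U" "p \<in> U"
    and less: "frechet_derivative (\<lambda>x. frechet_derivative f (at x) u) (at p) v < c"
      "c < frechet_derivative (\<lambda>x. frechet_derivative f (at x) v) (at p) u"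
  shows False
proof -
  define Dv where "Dv w x = frechet_derivative f (at x) w" for w x
  define DD where "DD w z x = frechet_derivative (Dv w) (at x) z" for w z x
  have f1: "Ck_on (Suc (Suc 0)) U f" using f by (simp add: numeral_2_eq_2)
  have df: "(f has_derivative (\<lambda>w. Dv w x)) (at x)" if "x \<in> U" for x
    using Ck_on_SucD(1)[OF f1 that] by (simp add: Dv_def)
  have C1: "Ck_on (Suc 0) U (Dv w)" for w
    using Ck_on_SucD(2)[OF f1, of w] unfolding Dv_def .
  have dd: "(Dv w has_derivative (\<lambda>z. DD w z x)) (at x)" if "x \<in> U" for x w
    using Ck_on_SucD(1)[OF C1 that] by (simp add: DD_def)
  have C0: "continuous_on U (DD w z)" for w z
    using Ck_on_SucD(2)[OF C1[of w], of z] unfolding DD_def by simp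
  have "open (U \<inter> DD u v -` {..<c})" "open (U \<inter> DD v u -` {c<..})"
    using C0 U(1) by (auto intro!: continuous_open_preimage)
  moreover have "U \<inter> DD u v -` {..<c} = {x \<in> U. DD u v x < c}" "U \<inter> DD v u -` {c<..} = {x \<in> U. c < DD v u x}"
    by auto
  ultimately have "open ({x \<in> U. DD u v x < c} \<inter> {x \<in> U. c < DD v u x})" by (metis open_Int)
  moreover have "p \<in> {x \<in> U. DD u v x < c} \<inter> {x \<in> U. c < DD v u x}"
    using less U(2) by (simp add: DD_def Dv_def[abs_def])
  ultimately obtain r where r: "r > 0"
    and ball: "ball p r \<subseteq> {x \<in> U. DD u v x < c} \<inter> {x \<in> U. c < DD v u x}"
    by (meson open_contains_ball)
  \<comment> \<open>Small enough for the parallelogram to stay within distance \<open>r / 2\<close>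
    of \<open>p\<close>; the summand 1 keeps the denominator positive when \<open>u\<close> and
    \<open>v\<close> vanish.\<close>
  define h where "h = r / (2 * (norm u + norm v + 1))"
  have nn: "norm u + norm v + 1 > 0" by (simp add: add_nonneg_pos)
  have h: "h > 0" using r nn by (simp add: h_def)
  have inb: "p + s *\<^sub>R u + t *\<^sub>R v \<in> ball p r" if "0 \<le> s" "s \<le> h" "0 \<le> t" "t \<le> h" for s t
  proof -
    have "norm (s *\<^sub>R u + t *\<^sub>R v) \<le> s * norm u + t * norm v"
      using that norm_triangle_ineq[of "s *\<^sub>R u" "t *\<^sub>R v"] by simp
    also have "\<dots> \<le> h * norm u + h * norm v"
      using that by (intro add_mono mult_right_mono) auto
    also have "\<dots> \<le> h * (norm u + norm v + 1)" using h by (simp add: algebra_simps)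
    also have "h * (norm u + norm v + 1) = r / 2" using nn by (simp add: h_def field_simps)
    also have "r / 2 < r" using r by simp
    finally show ?thesis by (simp add: dist_norm norm_minus_commute algebra_simps)
  qed
  have inU: "p + s *\<^sub>R u + t *\<^sub>R v \<in> U" if "0 \<le> s" "s \<le> h" "0 \<le> t" "t \<le> h" for s t
    using inb[OF that] ball by blast
  have ds: "((\<lambda>s. f (p + s *\<^sub>R u + t *\<^sub>R v)) has_real_derivative Dv u (p + s *\<^sub>R u + t *\<^sub>R v)) (at s)"
    and dsv: "((\<lambda>s. Dv v (p + s *\<^sub>R u + t *\<^sub>R v)) has_real_derivative DD v u (p + s *\<^sub>R u + t *\<^sub>R v)) (at s)"
    and dt: "((\<lambda>t. f (p + s *\<^sub>R u + t *\<^sub>R v)) has_real_derivative Dv v (p + s *\<^sub>R u + t *\<^sub>R v)) (at t)"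
    and dtu: "((\<lambda>t. Dv u (p + s *\<^sub>R u + t *\<^sub>R v)) has_real_derivative DD u v (p + s *\<^sub>R u + t *\<^sub>R v)) (at t)"
    if "0 \<le> s" "s \<le> h" "0 \<le> t" "t \<le> h" for s t
  proof -
    have *: "((\<lambda>s. G (p + s *\<^sub>R u + t *\<^sub>R v)) has_real_derivative G' u) (at s)"
      "((\<lambda>t. G (p + s *\<^sub>R u + t *\<^sub>R v)) has_real_derivative G' v) (at t)"
      if G: "(G has_derivative G') (at (p + s *\<^sub>R u + t *\<^sub>R v))" for G :: "'a \<Rightarrow> real" and G'
    proof -
      have lin: "G' (x *\<^sub>R w) = G' w * x" for x w
        using linear_scale[OF has_derivative_linear[OF G]] by (simp add: mult.commute)
      have "((\<lambda>s. p + s *\<^sub>R u + t *\<^sub>R v) has_derivative (\<lambda>x. x *\<^sub>R u)) (at s)"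
        by (auto intro!: derivative_eq_intros)
      from has_derivative_compose[OF this G]
      show "((\<lambda>s. G (p + s *\<^sub>R u + t *\<^sub>R v)) has_real_derivative G' u) (at s)"
        by (simp add: has_field_derivative_def lin)
      have "((\<lambda>t. p + s *\<^sub>R u + t *\<^sub>R v) has_derivative (\<lambda>x. x *\<^sub>R v)) (at t)"
        by (auto intro!: derivative_eq_intros)
      from has_derivative_compose[OF this G]
      show "((\<lambda>t. G (p + s *\<^sub>R u + t *\<^sub>R v)) has_real_derivative G' v) (at t)"
        by (simp add: has_field_derivative_def lin)
    qed
    note q = inU[OF that]
    show "((\<lambda>s. f (p + s *\<^sub>R u + t *\<^sub>R v)) has_real_derivative Dv u (p + s *\<^sub>R u + t *\<^sub>R v)) (at s)"
      "((\<lambda>s. Dv v (p + s *\<^sub>R u + t *\<^sub>R v)) has_real_derivative DD v u (p + s *\<^sub>R u + t *\<^sub>R v)) (at s)"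
      "((\<lambda>t. f (p + s *\<^sub>R u + t *\<^sub>R v)) has_real_derivative Dv v (p + s *\<^sub>R u + t *\<^sub>R v)) (at t)"
      "((\<lambda>t. Dv u (p + s *\<^sub>R u + t *\<^sub>R v)) has_real_derivative DD u v (p + s *\<^sub>R u + t *\<^sub>R v)) (at t)"
      using *[OF df[OF q]] *[OF dd[OF q]] by simp_all
  qed
  \<comment> \<open>The zero multiples are kept so that all four corners are values of the functions
    of \<open>s\<close> and \<open>t\<close> fed to \<open>MVT2\<close>.\<close>
  define \<Delta> where "\<Delta> = f (p + h *\<^sub>R u + h *\<^sub>R v) - f (p + h *\<^sub>R u + 0 *\<^sub>R v)
    - (f (p + 0 *\<^sub>R u + h *\<^sub>R v) - f (p + 0 *\<^sub>R u + 0 *\<^sub>R v))"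
  obtain \<xi> where \<xi>: "0 < \<xi>" "\<xi> < h"
    "\<Delta> = (h - 0) * (Dv u (p + \<xi> *\<^sub>R u + h *\<^sub>R v) - Dv u (p + \<xi> *\<^sub>R u + 0 *\<^sub>R v))"
  proof (atomize_elim, unfold \<Delta>_def, rule MVT2[OF h])
    fix x assume "0 \<le> x" "x \<le> h"
    then show "((\<lambda>s. f (p + s *\<^sub>R u + h *\<^sub>R v) - f (p + s *\<^sub>R u + 0 *\<^sub>R v)) has_real_derivative
        Dv u (p + x *\<^sub>R u + h *\<^sub>R v) - Dv u (p + x *\<^sub>R u + 0 *\<^sub>R v)) (at x)"
      using h by (intro DERIV_diff ds) auto
  qed
  obtain \<eta> where \<eta>: "0 < \<eta>" "\<eta> < h"
    "Dv u (p + \<xi> *\<^sub>R u + h *\<^sub>R v) - Dv u (p + \<xi> *\<^sub>R u + 0 *\<^sub>R v) = (h - 0) * DD u v (p + \<xi> *\<^sub>R u + \<eta> *\<^sub>R v)"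
    using \<xi> by (atomize_elim, intro MVT2[OF h] dtu) auto
  have 1: "\<Delta> < h * (h * c)"
    using \<xi> \<eta> h inb[of \<xi> \<eta>] ball by auto
  \<comment> \<open>The same four corners, paired so that the mean value theorem now applies in the
    direction \<open>v\<close> first.\<close>
  have \<Delta>_alt: "\<Delta> = f (p + h *\<^sub>R u + h *\<^sub>R v) - f (p + 0 *\<^sub>R u + h *\<^sub>R v)
    - (f (p + h *\<^sub>R u + 0 *\<^sub>R v) - f (p + 0 *\<^sub>R u + 0 *\<^sub>R v))" by (simp add: \<Delta>_def)
  obtain \<eta> where \<eta>: "0 < \<eta>" "\<eta> < h"
    "\<Delta> = (h - 0) * (Dv v (p + h *\<^sub>R u + \<eta> *\<^sub>R v) - Dv v (p + 0 *\<^sub>R u + \<eta> *\<^sub>R v))"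
  proof (atomize_elim, unfold \<Delta>_alt, rule MVT2[OF h])
    fix x assume "0 \<le> x" "x \<le> h"
    then show "((\<lambda>t. f (p + h *\<^sub>R u + t *\<^sub>R v) - f (p + 0 *\<^sub>R u + t *\<^sub>R v)) has_real_derivative
        Dv v (p + h *\<^sub>R u + x *\<^sub>R v) - Dv v (p + 0 *\<^sub>R u + x *\<^sub>R v)) (at x)"
      using h by (intro DERIV_diff dt) auto
  qed
  obtain \<xi> where \<xi>: "0 < \<xi>" "\<xi> < h"
    "Dv v (p + h *\<^sub>R u + \<eta> *\<^sub>R v) - Dv v (p + 0 *\<^sub>R u + \<eta> *\<^sub>R v) = (h - 0) * DD v u (p + \<xi> *\<^sub>R u + \<eta> *\<^sub>R v)"
    using \<eta> by (atomize_elim, intro MVT2[OF h] dsv) auto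
  have 2: "\<Delta> > h * (h * c)"
    using \<xi> \<eta> h inb[of \<xi> \<eta>] ball by auto
  show False using 1 2 by simp
qed

text \<open>Componentwise: if two real components differed, a number strictly between them would
  contradict the previous lemma, used with \<open>u\<close> and \<open>v\<close> in one order or the
  other.\<close>

lemma second_derivative_symmetric:
  fixes f :: "'a::euclidean_space \<Rightarrow> 'b::euclidean_space"
  assumes f: "Ck_on 2 U f" and U: "open U" "p \<in> U"
  shows "frechet_derivative (\<lambda>x. frechet_derivative f (at x) u) (at p) v
    = frechet_derivative (\<lambda>x. frechet_derivative f (at x) v) (at p) u"
proof (rule euclidean_eqI)
  fix b :: 'b assume "b \<in> Basis"
  let ?g = "\<lambda>x. f x \<bullet> b"
  have g: "Ck_on 2 U ?g"
    by (rule Ck_on_bounded_linear[OF bounded_linear_inner_left U(1) f])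
  have f1: "Ck_on (Suc (Suc 0)) U f" using f by (simp add: numeral_2_eq_2)
  have 1: "frechet_derivative ?g (at x) w = frechet_derivative f (at x) w \<bullet> b" if "x \<in> U" for x w
    using bounded_linear.has_derivative[OF bounded_linear_inner_left Ck_on_SucD(1)[OF f1 that], of b]
    by (metis frechet_derivative_at)
  have 2: "frechet_derivative (\<lambda>x. frechet_derivative ?g (at x) w) (at p) z
     = frechet_derivative (\<lambda>x. frechet_derivative f (at x) w) (at p) z \<bullet> b" for w z
  proof -
    have "((\<lambda>x. frechet_derivative f (at x) w \<bullet> b) has_derivative
      (\<lambda>z. frechet_derivative (\<lambda>x. frechet_derivative f (at x) w) (at p) z \<bullet> b)) (at p)"
      using bounded_linear.has_derivative[OF bounded_linear_inner_left
          Ck_on_SucD(1)[OF Ck_on_SucD(2)[OF f1] U(2)]] .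
    then have "((\<lambda>x. frechet_derivative ?g (at x) w) has_derivative
      (\<lambda>z. frechet_derivative (\<lambda>x. frechet_derivative f (at x) w) (at p) z \<bullet> b)) (at p)"
      by (rule has_derivative_transform_within_open[OF _ U]) (simp add: 1)
    then show ?thesis by (metis frechet_derivative_at)
  qed
  show "frechet_derivative (\<lambda>x. frechet_derivative f (at x) u) (at p) v \<bullet> b
    = frechet_derivative (\<lambda>x. frechet_derivative f (at x) v) (at p) u \<bullet> b"
    using mixed_derivatives_separated[OF g U] 2 dense by (metis linorder_neqE)
qed

section \<open>Submanifolds and tangent spaces\<close>

abbreviation Ck_within :: "nat \<Rightarrow> 'a::euclidean_space set \<Rightarrow> ('a \<Rightarrow> 'b::real_normed_vector) \<Rightarrow> bool" where
  "Ck_within k \<equiv> of_class_within (C_fin k)"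

lemma Ck_withinE:
  assumes "Ck_within k V f" "p \<in> V"
  obtains U g where "open U" "p \<in> U" "Ck_on k U g" "\<And>x. x \<in> V \<Longrightarrow> x \<in> U \<Longrightarrow> g x = f x"
  using assms unfolding of_class_within_def by (auto simp: Ball_def)

lemma Ck_withinI:
  assumes "\<And>p. p \<in> V \<Longrightarrow> \<exists>U g. open U \<and> p \<in> U \<and> Ck_on k U g \<and> (\<forall>x\<in>V \<inter> U. g x = f x)"
  shows "Ck_within k V f"
  using assms unfolding of_class_within_def by simp

lemma Ck_within_cong: "Ck_within k V f \<Longrightarrow> (\<And>x. x \<in> V \<Longrightarrow> f x = g x) \<Longrightarrow> Ck_within k V g"
  unfolding of_class_within_def by (metis IntD1)

text \<open>The closure property is assumed for all functions on open sets because it is applied to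
  a local extension of \<open>f\<close>, not to \<open>f\<close> itself.\<close>

lemma Ck_within_lift:
  fixes f :: "'a::euclidean_space \<Rightarrow> 'b::real_normed_vector"
  assumes "Ck_within k V f"
    and "\<And>(U :: 'a set) f. open U \<Longrightarrow> Ck_on k U f \<Longrightarrow> Ck_on l U (\<lambda>x. h (f x))"
  shows "Ck_within l V (\<lambda>x. h (f x))"
proof (rule Ck_withinI)
  fix p assume p: "p \<in> V"
  obtain U g where "open U" "p \<in> U" "Ck_on k U g"
    "\<And>x. x \<in> V \<Longrightarrow> x \<in> U \<Longrightarrow> g x = f x"
    by (rule Ck_withinE[OF assms(1) p]) blast
  then show "\<exists>U g. open U \<and> p \<in> U \<and> Ck_on l U g \<and> (\<forall>x\<in>V \<inter> U. g x = h (f x))"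
    using assms(2)[of U g] by (intro exI[of _ U] exI[of _ "\<lambda>x. h (g x)"]) auto
qed

lemma Ck_within_lift2:
  fixes f :: "'a::euclidean_space \<Rightarrow> 'b::real_normed_vector" and g :: "'a \<Rightarrow> 'c::real_normed_vector"
  assumes "Ck_within k V f" "Ck_within k V g"
    and "\<And>(U :: 'a set) f g. open U \<Longrightarrow> Ck_on k U f \<Longrightarrow> Ck_on k U g \<Longrightarrow> Ck_on l U (\<lambda>x. h (f x) (g x))"
  shows "Ck_within l V (\<lambda>x. h (f x) (g x))"
proof (rule Ck_withinI)
  fix p assume p: "p \<in> V"
  obtain U f' where U: "open U" "p \<in> U" "Ck_on k U f'"
    "\<And>x. x \<in> V \<Longrightarrow> x \<in> U \<Longrightarrow> f' x = f x"
    by (rule Ck_withinE[OF assms(1) p]) blast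
  obtain W g' where W: "open W" "p \<in> W" "Ck_on k W g'"
    "\<And>x. x \<in> V \<Longrightarrow> x \<in> W \<Longrightarrow> g' x = g x"
    by (rule Ck_withinE[OF assms(2) p]) blast
  show "\<exists>U g'. open U \<and> p \<in> U \<and> Ck_on l U g' \<and> (\<forall>x\<in>V \<inter> U. g' x = h (f x) (g x))"
    using assms(3)[of "U \<inter> W" f' g'] U W
    by (intro exI[of _ "U \<inter> W"] exI[of _ "\<lambda>x. h (f' x) (g' x)"]) (auto intro: Ck_on_subset)
qed

lemma Ck_within_mono: "Ck_within k V f \<Longrightarrow> l \<le> k \<Longrightarrow> Ck_within l V f"
  using Ck_within_lift[of k V f l "\<lambda>x. x"] Ck_on_mono by auto

lemma Ck_within_const: "Ck_within k V (\<lambda>x. c)"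
  by (rule Ck_withinI) (auto intro!: exI[of _ UNIV] exI[of _ "\<lambda>x. c"] Ck_on_const)

lemma Ck_within_bounded_linear: "bounded_linear h \<Longrightarrow> Ck_within k V f \<Longrightarrow> Ck_within k V (\<lambda>x. h (f x))"
  by (erule Ck_within_lift) (rule Ck_on_bounded_linear)

lemma Ck_within_add: "Ck_within k V f \<Longrightarrow> Ck_within k V g \<Longrightarrow> Ck_within k V (\<lambda>x. f x + g x)"
  by (erule Ck_within_lift2, assumption) (rule Ck_on_add)

lemma Ck_within_bilinear:
  "bounded_bilinear h \<Longrightarrow> Ck_within k V f \<Longrightarrow> Ck_within k V g \<Longrightarrow> Ck_within k V (\<lambda>x. h (f x) (g x))"
  by (erule Ck_within_lift2, assumption) (rule Ck_on_bilinear)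

lemma Ck_within_uminus: "Ck_within k V f \<Longrightarrow> Ck_within k V (\<lambda>x. - f x)"
  using Ck_within_bounded_linear[OF bounded_linear_minus[OF bounded_linear_ident]] .

lemma Ck_within_diff: "Ck_within k V f \<Longrightarrow> Ck_within k V g \<Longrightarrow> Ck_within k V (\<lambda>x. f x - g x)"
  using Ck_within_add[of k V f "\<lambda>x. - g x"] Ck_within_uminus[of k V g] by simp

lemma Ck_within_mult:
  fixes f g :: "'a::euclidean_space \<Rightarrow> 'b::real_normed_algebra"
  shows "Ck_within k V f \<Longrightarrow> Ck_within k V g \<Longrightarrow> Ck_within k V (\<lambda>x. f x * g x)"
  by (rule Ck_within_bilinear[OF bounded_bilinear_mult])

lemma Ck_within_cnj: "Ck_within k V f \<Longrightarrow> Ck_within k V (\<lambda>x. cnj (f x))"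
  by (rule Ck_within_bounded_linear[OF bounded_linear_cnj])

lemma bounded_bilinear_cscale:
  "bounded_bilinear (cscale :: complex \<Rightarrow> 'a::euclidean_space \<times> 'a \<Rightarrow> 'a \<times> 'a)"
  by (rule bilinear_conv_bounded_bilinear[THEN iffD1])
    (auto simp: bilinear_def cscale_def algebra_simps intro!: linearI)

lemma bounded_linear_cconj: "bounded_linear (cconj :: 'a::euclidean_space \<times> 'a \<Rightarrow> 'a \<times> 'a)"
  by (rule linear_conv_bounded_linear[THEN iffD1]) (auto simp: cconj_def intro!: linearI)

lemma Ck_within_cscale:
  fixes X :: "'a::euclidean_space \<Rightarrow> 'b::euclidean_space \<times> 'b"
  shows "Ck_within k V f \<Longrightarrow> Ck_within k V X \<Longrightarrow> Ck_within k V (\<lambda>x. cscale (f x) (X x))"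
  by (rule Ck_within_bilinear[OF bounded_bilinear_cscale])

text \<open>Meant for the factor between two generators: \<open>f\<close> and \<open>g\<close> will
  be components of them, and which component is nonzero depends on the point
  \<open>p\<close>.\<close>

lemma Ck_within_divide_locally:
  fixes a :: "'a::euclidean_space \<Rightarrow> 'b::real_normed_field"
  assumes loc: "\<And>p. p \<in> V \<Longrightarrow> \<exists>f g :: 'a \<Rightarrow> 'b. Ck_within k V f \<and> Ck_within k V g \<and> g p \<noteq> 0 \<and> (\<forall>x\<in>V. f x = a x * g x)"
  shows "Ck_within k V a"
proof (rule Ck_withinI)
  fix p assume p: "p \<in> V"
  from loc[OF p] obtain f g where f: "Ck_within k V (f :: 'a \<Rightarrow> 'b)" and g: "Ck_within k V (g :: 'a \<Rightarrow> 'b)"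
    and nz: "g p \<noteq> 0" and eq: "\<forall>x\<in>V. f x = a x * g x" by blast
  obtain U f' where U: "open U" "p \<in> U" "Ck_on k U f'"
    "\<And>x. x \<in> V \<Longrightarrow> x \<in> U \<Longrightarrow> f' x = f x"
    by (rule Ck_withinE[OF f p]) blast
  obtain W g' where W: "open W" "p \<in> W" "Ck_on k W g'"
    "\<And>x. x \<in> V \<Longrightarrow> x \<in> W \<Longrightarrow> g' x = g x"
    by (rule Ck_withinE[OF g p]) blast
  \<comment> \<open>The extension \<open>g'\<close> agrees with \<open>g\<close> only on
    \<open>V\<close>, so its zeros off \<open>V\<close> have to be removed as well.\<close>
  define Z where "Z = U \<inter> (W \<inter> g' -` (- {0}))"
  have "continuous_on W g'" using W(3) Ck_on_mono[of k W g' 0] by simp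
  then have Z: "open Z" unfolding Z_def
    using U W by (intro open_Int continuous_open_preimage) auto
  have "Ck_on k Z (\<lambda>x. f' x * inverse (g' x))"
    by (intro Ck_on_bilinear[OF bounded_bilinear_mult] Ck_on_inverse Z
        Ck_on_subset[OF U(3)] Ck_on_subset[OF W(3)]) (auto simp: Z_def)
  moreover have "p \<in> Z" using U W nz p by (auto simp: Z_def)
  moreover have "f' x * inverse (g' x) = a x" if "x \<in> V \<inter> Z" for x
    using that U W eq by (auto simp: Z_def field_simps)
  ultimately show "\<exists>U g. open U \<and> p \<in> U \<and> Ck_on k U g \<and> (\<forall>x\<in>V \<inter> U. g x = a x)"
    using Z by blast
qed

section \<open>Derivatives within a set and curves in it\<close>

lemma has_derivative_within_extension:
  assumes "open U" "p \<in> U" "p \<in> V" "(g has_derivative g') (at p)"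
    "\<And>x. x \<in> V \<Longrightarrow> x \<in> U \<Longrightarrow> g x = f x"
  shows "(f has_derivative g') (at p within V)"
proof -
  have "(g has_derivative g') (at p within V \<inter> U)"
    using assms(4) has_derivative_at_withinI by blast
  then have "(f has_derivative g') (at p within V \<inter> U)"
    by (rule has_derivative_transform[rotated 2]) (use assms in auto)
  moreover have "at p within V \<inter> U = at p within V"
    using assms by (intro at_within_nhd[of p U]) auto
  ultimately show ?thesis by simp
qed

text \<open>Even where derivatives within \<open>V\<close> are not unique, the one selected by
  \<open>frechet_derivative\<close> is a genuine derivative, since a local extension supplies at
  least one.\<close>

lemma Ck_within_has_derivative:
  assumes "Ck_within k V f" "p \<in> V" "0 < k"
  shows "(f has_derivative frechet_derivative f (at p within V)) (at p within V)"
proof -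
  obtain U g where U: "open U" "p \<in> U" "Ck_on k U g"
    "\<And>x. x \<in> V \<Longrightarrow> x \<in> U \<Longrightarrow> g x = f x"
    by (rule Ck_withinE[OF assms(1,2)]) blast
  obtain l where "k = Suc l" using assms(3) by (cases k) auto
  then have "(g has_derivative frechet_derivative g (at p)) (at p)"
    using Ck_on_SucD(1) U by blast
  from has_derivative_within_extension[OF U(1,2) assms(2) this U(4)] show ?thesis
    using frechet_derivative_works differentiable_def by blast
qed

text \<open>Pairing with a vector orthogonal to \<open>S\<close> turns the curve into the zero
  function, so the derivative is orthogonal to the complement of \<open>S\<close>, and
  \<open>S\<close> is its own double complement.\<close>

lemma vector_derivative_in_subspace:
  fixes S :: "'a::euclidean_space set"
  assumes f: "(f has_vector_derivative v) (at 0)" and S: "subspace S"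
    and e: "e > 0" "\<And>t. t \<in> {-e<..<e} \<Longrightarrow> f t \<in> S"
  shows "v \<in> S"
proof -
  have "v \<bullet> y = 0" if y: "\<And>x. x \<in> S \<Longrightarrow> x \<bullet> y = 0" for y
  proof -
    have "((\<lambda>t. f t \<bullet> y) has_vector_derivative v \<bullet> y) (at 0)"
      using bounded_linear.has_vector_derivative[OF bounded_linear_inner_left f] .
    then have "((\<lambda>t. 0) has_vector_derivative v \<bullet> y) (at 0)"
      by (rule has_vector_derivative_transform_within_open[where S = "{-e<..<e}"]) (use e y in auto)
    then show ?thesis using vector_derivative_unique_at[OF has_vector_derivative_const] by metis
  qed
  then have "v \<in> orthogonal_comp (orthogonal_comp S)"
    by (simp add: orthogonal_comp_def orthogonal_def inner_commute)
  then show ?thesis using orthogonal_comp_self[OF S] by simp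
qed

lemma curve_derivative:
  assumes "(G has_derivative G') (at p within V)" "\<gamma> ` {-e<..<e} \<subseteq> V" "\<gamma> 0 = p" "0 < e"
    "(\<gamma> has_vector_derivative v) (at 0)"
  shows "((\<lambda>t. G (\<gamma> t)) has_vector_derivative G' v) (at (0::real))"
proof -
  have o: "at 0 within {-e<..<e} = at 0" using assms(4) by (intro at_within_open) auto
  have "(\<gamma> has_derivative (\<lambda>x. x *\<^sub>R v)) (at 0 within {-e<..<e})"
    using assms(5) unfolding o has_vector_derivative_def .
  moreover have "(G has_derivative G') (at (\<gamma> 0) within \<gamma> ` {-e<..<e})"
    using assms has_derivative_subset by blast
  ultimately have "((\<lambda>t. G (\<gamma> t)) has_derivative (\<lambda>x. G' (x *\<^sub>R v))) (at 0 within {-e<..<e})"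
    by (rule has_derivative_in_compose)
  then show ?thesis
    unfolding o has_vector_derivative_def
    using linear_scale[OF has_derivative_linear[OF assms(1)]] by simp
qed

lemma derivative_within_unique_on_tangent:
  assumes "(G has_derivative G1) (at p within V)" "(G has_derivative G2) (at p within V)"
    "v \<in> tangent_space V p"
  shows "G1 v = G2 v"
  using assms(3) curve_derivative[OF assms(1)] curve_derivative[OF assms(2)]
    vector_derivative_unique_at unfolding tangent_space_def by blast

lemma derivative_within_in_subspace:
  fixes S :: "'b::euclidean_space set"
  assumes "(G has_derivative G') (at p within V)" "v \<in> tangent_space V p"
    and "subspace S" "\<And>q. q \<in> V \<Longrightarrow> G q \<in> S"
  shows "G' v \<in> S"
proof -
  from assms(2) obtain \<gamma> e where g: "0 < e" "\<gamma> ` {-e<..<e} \<subseteq> V" "\<gamma> 0 = p"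
     "(\<gamma> has_vector_derivative v) (at (0::real))" unfolding tangent_space_def by blast
  show ?thesis
    by (rule vector_derivative_in_subspace[OF curve_derivative[OF assms(1) g(2,3,1,4)] assms(3) g(1)])
      (use g assms(4) in blast)
qed

section \<open>Tangent spaces and charts\<close>

text \<open>A curve in \<open>M\<close> through \<open>p\<close> stays in \<open>V\<close> for short
  times, by continuity at 0.\<close>

lemma tangent_space_openin:
  assumes "openin (top_of_set M) V" "p \<in> V"
  shows "tangent_space V p = tangent_space M p"
proof
  have "V \<subseteq> M" using assms(1) openin_imp_subset by blast
  then show "tangent_space V p \<subseteq> tangent_space M p" unfolding tangent_space_def by blast
  show "tangent_space M p \<subseteq> tangent_space V p"
  proof
    fix v assume "v \<in> tangent_space M p"
    then obtain \<gamma> e where g: "0 < e" "\<gamma> ` {-e<..<e} \<subseteq> M" "\<gamma> 0 = p"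
      "(\<gamma> has_vector_derivative v) (at (0::real))" unfolding tangent_space_def by blast
    obtain O' where O: "open O'" "V = M \<inter> O'" using assms(1) openin_open by blast
    have "isCont \<gamma> 0"
      using g(4) has_vector_derivative_continuous by blast
    then have "\<gamma> \<midarrow>0\<rightarrow> p" using g(3) by (simp add: isCont_def)
    then have "\<forall>\<^sub>F t in at 0. \<gamma> t \<in> O'"
      using O assms(2) by (intro topological_tendstoD) auto
    then obtain \<delta> where d: "\<delta> > 0" "\<And>t. t \<noteq> 0 \<Longrightarrow> dist t 0 < \<delta> \<Longrightarrow> \<gamma> t \<in> O'"
      unfolding eventually_at by blast
    have "\<gamma> t \<in> V" if "t \<in> {-min e \<delta><..<min e \<delta>}" for t
      using that g(2,3) d(2)[of t] O(2) assms(2) by (cases "t = 0") (auto simp: image_subset_iff)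
    then have "\<gamma> ` {-min e \<delta><..<min e \<delta>} \<subseteq> V" by blast
    then show "v \<in> tangent_space V p"
      unfolding tangent_space_def mem_Collect_eq using g d(1)
      by (intro exI[of _ \<gamma>] exI[of _ "min e \<delta>"]) simp
  qed
qed

text \<open>One chart describes the tangent spaces at all points near \<open>p\<close>, which is
  what later allows the condition of being tangent to be differentiated in \<open>q\<close>. The
  derivative of the chart takes velocities of curves in \<open>M\<close> into \<open>S\<close>;
  conversely the inverse chart carries straight lines in \<open>S\<close> to curves in
  \<open>M\<close>.\<close>

lemma submanifold_tangent_chart:
  fixes M :: "'a::euclidean_space set"
  assumes "submanifold (C_fin (Suc k)) d M" "p \<in> M"
  obtains U \<Phi> S where "open U" "p \<in> U" "Ck_on (Suc k) U (\<Phi> :: 'a \<Rightarrow> 'a)" "subspace S"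
    "\<And>q. q \<in> M \<Longrightarrow> q \<in> U \<Longrightarrow> tangent_space M q = {v. frechet_derivative \<Phi> (at q) v \<in> S}"
    "\<And>q. q \<in> M \<Longrightarrow> q \<in> U \<Longrightarrow> dim (tangent_space M q) = d"
proof -
  obtain U W and \<Phi> \<Psi> :: "'a \<Rightarrow> 'a" and S where hom: "homeomorphism U W \<Phi> \<Psi>" and U: "open U" "p \<in> U" "open W"
    and C: "Ck_on (Suc k) U \<Phi>" "Ck_on (Suc k) W \<Psi>" and S: "subspace S" "dim S = d"
    and im: "\<Phi> ` (M \<inter> U) = W \<inter> S"
    using bspec[OF assms(1)[unfolded submanifold_def of_class.simps] assms(2)]
    by (elim exE conjE) (rule that; assumption)
  have main: "tangent_space M q = {v. frechet_derivative \<Phi> (at q) v \<in> S} \<and> dim (tangent_space M q) = d"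
    if q: "q \<in> M" "q \<in> U" for q
  proof -
    define A where "A = frechet_derivative \<Phi> (at q)"
    define B where "B = frechet_derivative \<Psi> (at (\<Phi> q))"
    have qW: "\<Phi> q \<in> W" and \<Psi>q: "\<Psi> (\<Phi> q) = q" using hom q by (auto simp: homeomorphism_def)
    have A: "(\<Phi> has_derivative A) (at q)" unfolding A_def using Ck_on_SucD(1)[OF C(1) q(2)] .
    have B: "(\<Psi> has_derivative B) (at (\<Phi> q))" unfolding B_def using Ck_on_SucD(1)[OF C(2) qW] .
    \<comment> \<open>The chain rule for the two compositions of the chart and its inverse makes
      \<open>A\<close> and \<open>B\<close> inverse linear maps.\<close>
    have BA: "B (A v) = v" for v
    proof -
      have "((\<lambda>x. x) has_derivative (\<lambda>v. B (A v))) (at q)"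
        by (rule has_derivative_transform_within_open[OF has_derivative_compose[OF A B] U(1) q(2)])
          (use hom in \<open>auto simp: homeomorphism_def\<close>)
      then show ?thesis using has_derivative_unique[OF has_derivative_ident] by metis
    qed
    have AB: "A (B v) = v" for v
    proof -
      have "((\<lambda>x. x) has_derivative (\<lambda>v. A (B v))) (at (\<Phi> q))"
        by (rule has_derivative_transform_within_open[OF has_derivative_compose[OF B, unfolded \<Psi>q, OF A] U(3) qW])
          (use hom in \<open>auto simp: homeomorphism_def\<close>)
      then show ?thesis using has_derivative_unique[OF has_derivative_ident] by metis
    qed
    have "openin (top_of_set M) (M \<inter> U)" using U(1) by blast
    then have TM: "tangent_space (M \<inter> U) q = tangent_space M q"
      using q by (intro tangent_space_openin) auto
    have 1: "A v \<in> S" if "v \<in> tangent_space M q" for v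
      using that unfolding TM[symmetric]
      by (rule derivative_within_in_subspace[OF has_derivative_at_withinI[OF A] _ S(1)]) (use im in auto)
    have 2: "v \<in> tangent_space M q" if v: "A v \<in> S" for v
    proof -
      \<comment> \<open>A straight line in the flat model; its image under \<open>\<Psi>\<close> is
        a curve in \<open>M\<close> with velocity \<open>B (A v) = v\<close>.\<close>
      define l where "l t = \<Phi> q + t *\<^sub>R A v" for t
      have l: "(l has_vector_derivative A v) (at 0)"
        unfolding l_def by (auto intro!: derivative_eq_intros)
      have l0: "l 0 = \<Phi> q" by (simp add: l_def)
      have "continuous_on UNIV l" unfolding l_def by (intro continuous_intros)
      then have "open (l -` W)" using U(3) by (simp add: open_vimage)
      moreover have "0 \<in> l -` W" using qW by (simp add: l_def)
      ultimately obtain e where e: "e > 0" "ball 0 e \<subseteq> l -` W" using open_contains_ball by blast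
      have inS: "l t \<in> S" for t
        unfolding l_def using S(1) v im q by (intro subspace_add subspace_scale) auto
      have "\<Psi> (l t) \<in> M" if "t \<in> {-e<..<e}" for t
      proof -
        have "l t \<in> W" using e that by (auto simp: subset_iff dist_norm)
        then obtain x where "x \<in> M \<inter> U" "l t = \<Phi> x" using inS[of t] im by blast
        then show ?thesis using hom by (auto simp: homeomorphism_def)
      qed
      moreover have "((\<lambda>t. \<Psi> (l t)) has_vector_derivative B (A v)) (at 0)"
        by (rule curve_derivative[OF B subset_UNIV l0 e(1) l])
      ultimately show ?thesis
        unfolding tangent_space_def mem_Collect_eq BA using e(1) \<Psi>q l0
        by (intro exI[of _ "\<lambda>t. \<Psi> (l t)"] exI[of _ e]) auto
    qed
    have eq: "tangent_space M q = {v. A v \<in> S}" using 1 2 by blast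
    also have "\<dots> = B ` S"
      using AB by (auto simp: image_iff) (metis BA)
    finally have "dim (tangent_space M q) = dim (B ` S)" by simp
    also have "\<dots> = d"
      using S(2) dim_image_eq[OF has_derivative_linear[OF B], of S] AB by (metis inj_on_def)
    finally show ?thesis using eq by (simp add: A_def)
  qed
  show ?thesis by (rule that[OF U(1,2) C(1) S(1)]) (use main in blast)+
qed

lemma subspace_tangent_space:
  assumes "submanifold (C_fin (Suc k)) d M" "p \<in> M"
  shows "subspace (tangent_space M p)" and "dim (tangent_space M p) = d"
proof -
  from submanifold_tangent_chart[OF assms] obtain U \<Phi> S where U: "p \<in> U" "Ck_on (Suc k) U (\<Phi> :: 'a \<Rightarrow> 'a)" "subspace S"
    "tangent_space M p = {v. frechet_derivative \<Phi> (at p) v \<in> S}" "dim (tangent_space M p) = d"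
    using assms(2) by metis
  show "dim (tangent_space M p) = d" by fact
  have "linear (frechet_derivative \<Phi> (at p))"
    using Ck_on_SucD(1)[OF U(2,1)] has_derivative_linear by blast
  from linear_subspace_vimage[OF this U(3)] show "subspace (tangent_space M p)"
    by (simp add: U(4) vimage_def)
qed

text \<open>The condition that the derivative of \<open>\<Phi>\<close> maps a vector field \<open>X\<close> to \<open>S\<close> can be
  differentiated along \<open>Y\<close>; the second derivatives of \<open>\<Phi>\<close> cancel in the bracket.\<close>

lemma real_bracket_tangent:
  fixes M :: "'a::euclidean_space set"
  assumes M: "submanifold (C_fin 2) d M" and V: "openin (top_of_set M) V" "p \<in> V"
    and X: "Ck_within 1 V X" "\<And>q. q \<in> V \<Longrightarrow> X q \<in> tangent_space M q"
    and Y: "Ck_within 1 V Y" "\<And>q. q \<in> V \<Longrightarrow> Y q \<in> tangent_space M q"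
  shows "frechet_derivative Y (at p within V) (X p) - frechet_derivative X (at p within V) (Y p) \<in> tangent_space M p"
proof -
  have VM: "V \<subseteq> M" using V(1) openin_imp_subset by blast
  from submanifold_tangent_chart[OF M[unfolded numeral_2_eq_2], of p] obtain U \<Phi> S where
    U: "open U" "p \<in> U" "Ck_on (Suc (Suc 0)) U (\<Phi> :: 'a \<Rightarrow> 'a)" "subspace S"
    and T: "\<And>q. q \<in> M \<Longrightarrow> q \<in> U \<Longrightarrow> tangent_space M q = {v. frechet_derivative \<Phi> (at q) v \<in> S}"
    using V(2) VM by (metis subsetD)
  define D where "D v q = frechet_derivative \<Phi> (at q) v" for v q
  define H where "H u v = frechet_derivative (D u) (at p) v" for u v
  have dD: "(D b has_derivative H b) (at p)" for b
    unfolding H_def D_def[abs_def] using Ck_on_SucD(1)[OF Ck_on_SucD(2)[OF U(3)] U(2)] .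
  have linD: "linear (\<lambda>v. D v q)" if "q \<in> U" for q
    unfolding D_def using Ck_on_SucD(1)[OF U(3) that] has_derivative_linear by blast
  \<comment> \<open>This is the derivative along \<open>w\<close> of the map taking \<open>q\<close>
    to the image of \<open>Z q\<close> under the derivative of \<open>\<Phi>\<close> at
    \<open>q\<close>. The sum is the second derivative of \<open>\<Phi>\<close> in the directions
    \<open>Z p\<close> and \<open>w\<close>.\<close>
  have *: "(\<Sum>b\<in>Basis. (Z p \<bullet> b) *\<^sub>R H b w) + D (frechet_derivative Z (at p within V) w) p \<in> S"
    if Z: "Ck_within 1 V Z" "\<And>q. q \<in> V \<Longrightarrow> Z q \<in> tangent_space M q" and w: "w \<in> tangent_space M p" for Z w
  proof -
    let ?Z' = "frechet_derivative Z (at p within V)"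
    have Z': "(Z has_derivative ?Z') (at p within V)" using Ck_within_has_derivative[OF Z(1) V(2)] by simp
    \<comment> \<open>Coordinates separate the dependence on \<open>q\<close> through
      \<open>Z\<close> from that through the derivative of \<open>\<Phi>\<close>, so the product
      rule applies to each summand.\<close>
    define G where "G q = (\<Sum>b\<in>Basis. (Z q \<bullet> b) *\<^sub>R D b q)" for q
    have G: "G q = D (Z q) q" if "q \<in> U" for q
      unfolding G_def D_def using Ck_on_SucD(1)[OF U(3) that]
      by (intro frechet_derivative_coordinates[symmetric]) (auto simp: differentiable_def)
    have dG: "(G has_derivative (\<lambda>w. \<Sum>b\<in>Basis. (Z p \<bullet> b) *\<^sub>R H b w + (?Z' w \<bullet> b) *\<^sub>R D b p)) (at p within V)"
      unfolding G_def
      by (intro has_derivative_sum has_derivative_scaleR has_derivative_inner_left Z' has_derivative_at_withinI[OF dD])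
    have oV: "openin (top_of_set M) (V \<inter> U)" using V(1) U(1) by (simp add: openin_Int_open)
    have "w \<in> tangent_space (V \<inter> U) p"
      using w tangent_space_openin[OF oV] V U by auto
    from derivative_within_in_subspace[OF has_derivative_subset[OF dG, of "V \<inter> U"] this U(4)]
    have "(\<Sum>b\<in>Basis. (Z p \<bullet> b) *\<^sub>R H b w + (?Z' w \<bullet> b) *\<^sub>R D b p) \<in> S"
      using G Z(2) T VM by (auto simp: D_def)
    also have "(\<Sum>b\<in>Basis. (Z p \<bullet> b) *\<^sub>R H b w + (?Z' w \<bullet> b) *\<^sub>R D b p)
      = (\<Sum>b\<in>Basis. (Z p \<bullet> b) *\<^sub>R H b w) + D (?Z' w) p"
      unfolding sum.distrib D_def using Ck_on_SucD(1)[OF U(3,2)]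
      by (subst (2) frechet_derivative_coordinates) (auto simp: differentiable_def)
    finally show ?thesis .
  qed
  \<comment> \<open>Symmetry for fixed directions extends to the coordinate sums by linearity in the
    second argument.\<close>
  have H: "(\<Sum>b\<in>Basis. (x \<bullet> b) *\<^sub>R H b y) = (\<Sum>b\<in>Basis. (y \<bullet> b) *\<^sub>R H b x)" for x y
  proof -
    have sym: "H u v = H v u" for u v
      unfolding H_def D_def[abs_def] using second_derivative_symmetric[OF _ U(1,2)] U(3)
      by (metis numeral_2_eq_2)
    have lin: "linear (H b)" for b using dD has_derivative_linear by blast
    have "(\<Sum>b\<in>Basis. (x \<bullet> b) *\<^sub>R H b y) = H y x" for x y
      by (subst (2) euclidean_representation[of x, symmetric])
        (simp only: linear_sum[OF lin] linear_scale[OF lin] sym[of y])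
    then show ?thesis using sym[of x y] by metis
  qed
  have "D (frechet_derivative Y (at p within V) (X p)) p - D (frechet_derivative X (at p within V) (Y p)) p \<in> S"
    using subspace_diff[OF U(4) *[OF Y X(2)[OF V(2)]] *[OF X Y(2)[OF V(2)]]] H[of "X p" "Y p"] by simp
  then show ?thesis
    using T[of p] V(2) VM U(2) linear_diff[OF linD[OF U(2)]] by (auto simp: D_def)
qed

section \<open>Brackets of complexified tangent fields\<close>

text \<open>The derivative of a complex function along a complexified tangent vector, with the same
  caveat as for \<open>cderiv\<close>: only the values on tangent vectors are meaningful.\<close>

definition cderiv_fun :: "'a::real_normed_vector set \<Rightarrow> ('a \<Rightarrow> complex) \<Rightarrow> 'a \<Rightarrow> 'a \<times> 'a \<Rightarrow> complex" where
  "cderiv_fun V f p w = frechet_derivative f (at p within V) (fst w)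
     + \<i> * frechet_derivative f (at p within V) (snd w)"

lemma frechet_derivative_within_cong:
  assumes "p \<in> V" "\<And>q. q \<in> V \<Longrightarrow> f q = g q"
  shows "frechet_derivative f (at p within V) = frechet_derivative g (at p within V)"
proof -
  have "(f has_derivative D) (at p within V) = (g has_derivative D) (at p within V)" for D
    using assms has_derivative_transform[of p V f g D] has_derivative_transform[of p V g f D] by metis
  then show ?thesis by (simp add: frechet_derivative_def)
qed

lemma lie_bracket_cong:
  assumes "p \<in> V" "\<And>q. q \<in> V \<Longrightarrow> X q = X' q" "\<And>q. q \<in> V \<Longrightarrow> Y q = Y' q"
  shows "lie_bracket V X Y p = lie_bracket V X' Y' p"
  using frechet_derivative_within_cong[OF assms(1,2)] frechet_derivative_within_cong[OF assms(1,3)] assms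
  by (simp add: lie_bracket_def cderiv_def)

lemma lie_bracket_self [simp]: "lie_bracket V X X p = 0"
  by (simp add: lie_bracket_def)

lemma cconj_cscale: "cconj (cscale c w) = cscale (cnj c) (cconj w)"
  by (simp add: cconj_def cscale_def)

lemma fst_cscale: "fst (cscale c w) = Re c *\<^sub>R fst w - Im c *\<^sub>R snd w"
  and snd_cscale: "snd (cscale c w) = Re c *\<^sub>R snd w + Im c *\<^sub>R fst w"
  by (simp_all add: cscale_def)

text \<open>\<open>V\<close> is the domain of a generator. Class 2 of \<open>M\<close> is what
  \<open>real_bracket_tangent\<close> asks for.\<close>

locale submanifold_patch =
  fixes M V :: "'a::euclidean_space set" and d :: nat
  assumes submanifold_M: "submanifold (C_fin 2) d M"
    and openin_V: "openin (top_of_set M) V"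
begin

lemma subspace_tangent: "p \<in> V \<Longrightarrow> subspace (tangent_space M p)"
  using subspace_tangent_space(1)[OF submanifold_M[unfolded numeral_2_eq_2]] openin_imp_subset[OF openin_V]
  by blast

lemma dim_tangent: "p \<in> V \<Longrightarrow> dim (tangent_space M p) = d"
  using subspace_tangent_space(2)[OF submanifold_M[unfolded numeral_2_eq_2]] openin_imp_subset[OF openin_V]
  by blast

lemma csubspace_ctangent: "p \<in> V \<Longrightarrow> cvec.subspace (ctangent_space M p)"
  using subspace_tangent[of p]
  by (auto simp: cvec.subspace_def ctangent_space_def cscale_def subspace_0 zero_prod_def
      intro!: subspace_add subspace_diff subspace_scale)

text \<open>Makes the arbitrary choice computable: on tangent vectors it agrees with any derivative
  at hand, for instance one given by a product rule.\<close>

lemma frechet_derivative_tangent: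
  assumes "(f has_derivative f') (at p within V)" "p \<in> V" "v \<in> tangent_space M p"
  shows "frechet_derivative f (at p within V) v = f' v"
proof -
  have "(f has_derivative frechet_derivative f (at p within V)) (at p within V)"
    using assms(1) frechet_derivative_works differentiable_def by blast
  from derivative_within_unique_on_tangent[OF this assms(1)] show ?thesis
    using assms tangent_space_openin[OF openin_V] by auto
qed

lemma cderiv_eq:
  assumes "(Y has_derivative Y') (at p within V)" "p \<in> V" "w \<in> ctangent_space M p"
  shows "cderiv V Y p w = Y' (fst w) + cscale \<i> (Y' (snd w))"
  using assms frechet_derivative_tangent[OF assms(1,2)]
  by (auto simp: cderiv_def ctangent_space_def mem_Times_iff)

lemma cderiv_fun_eq:
  assumes "(f has_derivative f') (at p within V)" "p \<in> V" "w \<in> ctangent_space M p"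
  shows "cderiv_fun V f p w = f' (fst w) + \<i> * f' (snd w)"
  using assms frechet_derivative_tangent[OF assms(1,2)]
  by (auto simp: cderiv_fun_def ctangent_space_def mem_Times_iff)

lemma cderiv_add:
  assumes X: "Ck_within 1 V X" and Y: "Ck_within 1 V Y" and p: "p \<in> V" "w \<in> ctangent_space M p"
  shows "cderiv V (\<lambda>q. X q + Y q) p w = cderiv V X p w + cderiv V Y p w"
proof -
  have X': "(X has_derivative frechet_derivative X (at p within V)) (at p within V)"
    and Y': "(Y has_derivative frechet_derivative Y (at p within V)) (at p within V)"
    using Ck_within_has_derivative X Y p by auto
  show ?thesis
    unfolding cderiv_eq[OF has_derivative_add[OF X' Y'] p]
    by (simp add: cderiv_def cvec.scale_right_distrib)
qed

lemma cderiv_scale: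
  assumes f: "Ck_within 1 V f" and Y: "Ck_within 1 V Y" and p: "p \<in> V" "w \<in> ctangent_space M p"
  shows "cderiv V (\<lambda>q. cscale (f q) (Y q)) p w
    = cscale (cderiv_fun V f p w) (Y p) + cscale (f p) (cderiv V Y p w)"
proof -
  have f': "(f has_derivative frechet_derivative f (at p within V)) (at p within V)"
    and Y': "(Y has_derivative frechet_derivative Y (at p within V)) (at p within V)"
    using Ck_within_has_derivative f Y p by auto
  show ?thesis
    unfolding cderiv_eq[OF bounded_bilinear.FDERIV[OF bounded_bilinear_cscale f' Y'] p]
    by (simp add: cderiv_def cderiv_fun_def cvec.scale_right_distrib cvec.scale_left_distrib mult.commute)
qed

lemma cderiv_fun_cnj:
  assumes f: "Ck_within 1 V f" and p: "p \<in> V" "w \<in> ctangent_space M p"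
  shows "cderiv_fun V (\<lambda>q. cnj (f q)) p w = cnj (cderiv_fun V f p (cconj w))"
proof -
  have f': "(f has_derivative frechet_derivative f (at p within V)) (at p within V)"
    using Ck_within_has_derivative f p by auto
  have "(\<lambda>h. cnj (frechet_derivative f (at p within V) h)) (- v) = - cnj (frechet_derivative f (at p within V) v)" for v
    using linear_neg[OF has_derivative_linear[OF f']] by simp
  then show ?thesis
    unfolding cderiv_fun_eq[OF has_derivative_cnj[OF f'] p]
    by (simp add: cderiv_fun_def cconj_def)
qed

text \<open>Linearity in the direction holds on the whole ambient space, because the chosen
  derivative is a linear map even where its values are arbitrary.\<close>

lemma
  assumes Y: "Ck_within 1 V Y" and p: "p \<in> V"
  shows cderiv_add_vector: "cderiv V Y p (v + w) = cderiv V Y p v + cderiv V Y p w"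
    and cderiv_scale_vector: "cderiv V Y p (cscale c w) = cscale c (cderiv V Y p w)"
proof -
  have "linear (frechet_derivative Y (at p within V))"
    using Ck_within_has_derivative[OF Y p] has_derivative_linear by auto
  then show "cderiv V Y p (v + w) = cderiv V Y p v + cderiv V Y p w"
    "cderiv V Y p (cscale c w) = cscale c (cderiv V Y p w)"
    by (simp_all add: cderiv_def linear_add linear_diff linear_scale cvec.scale_right_distrib fst_cscale snd_cscale)
      (simp add: prod_eq_iff fst_cscale snd_cscale algebra_simps)
qed

text \<open>Differentiating an extension of \<open>Y\<close> along an extension of \<open>u\<close>
  gives an extension of the result; on \<open>V\<close> the values agree because \<open>u\<close> is
  tangent there.\<close>

lemma Ck_within_frechet_derivative:
  assumes Y: "Ck_within (Suc k) V Y" and u: "Ck_within k V u" "\<And>q. q \<in> V \<Longrightarrow> u q \<in> tangent_space M q"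
  shows "Ck_within k V (\<lambda>q. frechet_derivative Y (at q within V) (u q))"
proof (rule Ck_withinI)
  fix p assume p: "p \<in> V"
  obtain U g where U: "open U" "p \<in> U" "Ck_on (Suc k) U g"
    "\<And>x. x \<in> V \<Longrightarrow> x \<in> U \<Longrightarrow> g x = Y x"
    by (rule Ck_withinE[OF Y p]) blast
  obtain W h where W: "open W" "p \<in> W" "Ck_on k W h"
    "\<And>x. x \<in> V \<Longrightarrow> x \<in> W \<Longrightarrow> h x = u x"
    by (rule Ck_withinE[OF u(1) p]) blast
  have "Ck_on k (U \<inter> W) (\<lambda>x. frechet_derivative g (at x) (h x))"
    using U W by (intro Ck_on_derivative_along Ck_on_subset[OF U(3)] Ck_on_subset[OF W(3)]) auto
  moreover have "frechet_derivative g (at q) (h q) = frechet_derivative Y (at q within V) (u q)"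
    if q: "q \<in> V" "q \<in> U" "q \<in> W" for q
    using frechet_derivative_tangent[OF has_derivative_within_extension[OF U(1) q(2,1) Ck_on_SucD(1)[OF U(3) q(2)] U(4)] q(1) u(2)[OF q(1)]]
      W(4)[OF q(1,3)] by simp
  ultimately show "\<exists>U g. open U \<and> p \<in> U \<and> Ck_on k U g \<and>
      (\<forall>x\<in>V \<inter> U. g x = frechet_derivative Y (at x within V) (u x))"
    using U(1,2) W(1,2) by (intro exI[of _ "U \<inter> W"] exI[of _ "\<lambda>x. frechet_derivative g (at x) (h x)"]) auto
qed

text \<open>The index counts the derivatives still available: each bracket lowers it by one.\<close>

definition tangent_field :: "nat \<Rightarrow> ('a \<Rightarrow> 'a \<times> 'a) \<Rightarrow> bool" where
  "tangent_field k X \<longleftrightarrow> Ck_within k V X \<and> (\<forall>p\<in>V. X p \<in> ctangent_space M p)"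

lemma tangent_fieldD:
  assumes "tangent_field k X"
  shows "Ck_within k V X" "p \<in> V \<Longrightarrow> X p \<in> ctangent_space M p"
    "p \<in> V \<Longrightarrow> fst (X p) \<in> tangent_space M p" "p \<in> V \<Longrightarrow> snd (X p) \<in> tangent_space M p"
    "Ck_within k V (\<lambda>q. fst (X q))" "Ck_within k V (\<lambda>q. snd (X q))"
  using assms Ck_within_bounded_linear[OF bounded_linear_fst, of k V X]
    Ck_within_bounded_linear[OF bounded_linear_snd, of k V X]
  by (auto simp: tangent_field_def ctangent_space_def mem_Times_iff)

lemma tangent_field_mono: "tangent_field k X \<Longrightarrow> l \<le> k \<Longrightarrow> tangent_field l X"
  using Ck_within_mono by (auto simp: tangent_field_def)

lemma tangent_field_add: "tangent_field k X \<Longrightarrow> tangent_field k Y \<Longrightarrow> tangent_field k (\<lambda>q. X q + Y q)"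
  using cvec.subspace_add[OF csubspace_ctangent] by (auto simp: tangent_field_def intro: Ck_within_add)

lemma tangent_field_scale:
  "Ck_within k V f \<Longrightarrow> tangent_field k X \<Longrightarrow> tangent_field k (\<lambda>q. cscale (f q) (X q))"
  using cvec.subspace_scale[OF csubspace_ctangent] by (auto simp: tangent_field_def intro: Ck_within_cscale)

lemma tangent_field_cconj: "tangent_field k X \<Longrightarrow> tangent_field k (\<lambda>q. cconj (X q))"
  using Ck_within_bounded_linear[OF bounded_linear_cconj, of k V X] subspace_neg[OF subspace_tangent]
  by (auto simp: tangent_field_def ctangent_space_def cconj_def mem_Times_iff)

lemma Ck_within_cderiv_fun:
  assumes f: "Ck_within (Suc k) V f" and X: "tangent_field k X"
  shows "Ck_within k V (\<lambda>q. cderiv_fun V f q (X q))"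
  unfolding cderiv_fun_def
  by (intro Ck_within_add Ck_within_mult Ck_within_const Ck_within_frechet_derivative[OF f] tangent_fieldD[OF X])

lemma Ck_within_cderiv:
  assumes Y: "Ck_within (Suc k) V Y" and X: "tangent_field k X"
  shows "Ck_within k V (\<lambda>q. cderiv V Y q (X q))"
  unfolding cderiv_def
  by (intro Ck_within_add Ck_within_cscale Ck_within_const Ck_within_frechet_derivative[OF Y] tangent_fieldD[OF X])

text \<open>Writing \<open>X = X1 + i X2\<close> and \<open>Y = Y1 + i Y2\<close>, the real part is
  \<open>[X1, Y1] - [X2, Y2]\<close> and the imaginary part \<open>[X1, Y2] + [X2, Y1]\<close>, all
  brackets of real tangent fields.\<close>

lemma lie_bracket_ctangent:
  assumes X: "tangent_field 1 X" and Y: "tangent_field 1 Y" and p: "p \<in> V"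
  shows "lie_bracket V X Y p \<in> ctangent_space M p"
proof -
  let ?D = "\<lambda>f :: 'a \<Rightarrow> 'a. frechet_derivative f (at p within V)"
  \<comment> \<open>The choices made for \<open>Z\<close> and for its two components are unrelated,
    hence the restriction to tangent \<open>v\<close>.\<close>
  have D: "frechet_derivative Z (at p within V) v = (?D (\<lambda>q. fst (Z q)) v, ?D (\<lambda>q. snd (Z q)) v)"
    if "tangent_field 1 Z" "v \<in> tangent_space M p" for Z v
    using frechet_derivative_tangent[OF has_derivative_Pair[OF
        Ck_within_has_derivative[OF tangent_fieldD(5)[OF that(1)] p]
        Ck_within_has_derivative[OF tangent_fieldD(6)[OF that(1)] p]] p that(2)]
    by simp
  note X' = tangent_fieldD[OF X] and Y' = tangent_fieldD[OF Y]
  note sub = subspace_tangent[OF p]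
  note br = real_bracket_tangent[OF submanifold_M openin_V p]
  have "fst (lie_bracket V X Y p) =
      (?D (\<lambda>q. fst (Y q)) (fst (X p)) - ?D (\<lambda>q. fst (X q)) (fst (Y p)))
    - (?D (\<lambda>q. snd (Y q)) (snd (X p)) - ?D (\<lambda>q. snd (X q)) (snd (Y p)))"
    using X' Y' p by (simp add: lie_bracket_def cderiv_def D[OF X] D[OF Y] fst_cscale)
  also have "\<dots> \<in> tangent_space M p"
    by (intro subspace_diff[OF sub] br X' Y')
  finally have 1: "fst (lie_bracket V X Y p) \<in> tangent_space M p" .
  have "snd (lie_bracket V X Y p) =
      (?D (\<lambda>q. snd (Y q)) (fst (X p)) - ?D (\<lambda>q. fst (X q)) (snd (Y p)))
    + (?D (\<lambda>q. fst (Y q)) (snd (X p)) - ?D (\<lambda>q. snd (X q)) (fst (Y p)))"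
    using X' Y' p by (simp add: lie_bracket_def cderiv_def D[OF X] D[OF Y] snd_cscale)
  also have "\<dots> \<in> tangent_space M p"
    by (intro subspace_add[OF sub] br X' Y')
  finally have 2: "snd (lie_bracket V X Y p) \<in> tangent_space M p" .
  show ?thesis using 1 2 by (simp add: ctangent_space_def mem_Times_iff)
qed

lemma tangent_field_lie_bracket:
  assumes X: "tangent_field (Suc k) X" and Y: "tangent_field (Suc k) Y"
  shows "tangent_field k (lie_bracket V X Y)"
proof -
  have "Ck_within k V (lie_bracket V X Y)"
    unfolding lie_bracket_def
    by (intro Ck_within_diff Ck_within_cderiv tangent_fieldD(1)[OF X] tangent_fieldD(1)[OF Y]
        tangent_field_mono[OF X] tangent_field_mono[OF Y]) auto
  then show ?thesis
    using lie_bracket_ctangent tangent_field_mono[OF X, of 1] tangent_field_mono[OF Y, of 1]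
    by (auto simp: tangent_field_def)
qed

lemma lie_bracket_add_right:
  assumes Z: "tangent_field 1 Z" and X: "tangent_field 1 X" and Y: "tangent_field 1 Y" and p: "p \<in> V"
  shows "lie_bracket V Z (\<lambda>q. X q + Y q) p = lie_bracket V Z X p + lie_bracket V Z Y p"
  using cderiv_add[OF tangent_fieldD(1)[OF X] tangent_fieldD(1)[OF Y] p tangent_fieldD(2)[OF Z p]]
    cderiv_add_vector[OF tangent_fieldD(1)[OF Z] p]
  by (simp add: lie_bracket_def)

lemma lie_bracket_scale_scale:
  assumes L: "tangent_field 1 L" and X: "tangent_field 1 X"
    and a: "Ck_within 1 V a" and f: "Ck_within 1 V f" and p: "p \<in> V"
  shows "lie_bracket V (\<lambda>q. cscale (a q) (L q)) (\<lambda>q. cscale (f q) (X q)) p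
    = cscale (a p * f p) (lie_bracket V L X p) + cscale (a p * cderiv_fun V f p (L p)) (X p)
      - cscale (f p * cderiv_fun V a p (X p)) (L p)"
proof -
  have 1: "cderiv V (\<lambda>q. cscale (f q) (X q)) p (cscale (a p) (L p))
    = cscale (a p) (cscale (cderiv_fun V f p (L p)) (X p) + cscale (f p) (cderiv V X p (L p)))"
    using cderiv_scale[OF f tangent_fieldD(1)[OF X] p tangent_fieldD(2)[OF L p]]
      cderiv_scale_vector[OF Ck_within_cscale[OF f tangent_fieldD(1)[OF X]] p] by simp
  have 2: "cderiv V (\<lambda>q. cscale (a q) (L q)) p (cscale (f p) (X p))
    = cscale (f p) (cscale (cderiv_fun V a p (X p)) (L p) + cscale (a p) (cderiv V L p (X p)))"
    using cderiv_scale[OF a tangent_fieldD(1)[OF L] p tangent_fieldD(2)[OF X p]]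
      cderiv_scale_vector[OF Ck_within_cscale[OF a tangent_fieldD(1)[OF L]] p] by simp
  show ?thesis
    unfolding lie_bracket_def 1 2
    by (simp add: cvec.scale_right_distrib cvec.scale_right_diff_distrib mult.commute)
qed

text \<open>Serves to move the factor \<open>\<i>\<close> of \<open>T\<close> out of the nested
  brackets, so that \<open>S\<close> and \<open>R\<close> can be compared with the fields in the
  rank condition.\<close>

lemma lie_bracket_const_scale:
  assumes L: "tangent_field 1 L" and X: "tangent_field 1 X" and p: "p \<in> V"
  shows "lie_bracket V L (\<lambda>q. cscale c (X q)) p = cscale c (lie_bracket V L X p)"
proof -
  \<comment> \<open>Even for a constant, the chosen derivative within \<open>V\<close> is known to
    vanish on tangent vectors only.\<close>
  have "cderiv_fun V (\<lambda>q. c) p w = 0" if "w \<in> ctangent_space M p" for c w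
    using cderiv_fun_eq[OF has_derivative_const p that] by simp
  then show ?thesis
    using lie_bracket_scale_scale[OF L X Ck_within_const Ck_within_const p, of 1 c]
      tangent_fieldD(2)[OF X p] tangent_fieldD(2)[OF L p]
    by (simp add: cvec.scale_one)
qed

text \<open>The coefficients are wanted at \<open>p\<close> only, but those of \<open>T'\<close> and
  \<open>S'\<close> are built as functions on \<open>V\<close>, because the next bracket
  differentiates them: \<open>b\<close> has class 2, while \<open>e\<close>, \<open>d\<close> and
  \<open>c\<close> have class 1.\<close>

lemma frame_transformation:
  fixes L L' :: "'a \<Rightarrow> 'a \<times> 'a" and a :: "'a \<Rightarrow> complex"
  defines "Lb \<equiv> \<lambda>q. cconj (L q)" and "Lb' \<equiv> \<lambda>q. cconj (L' q)"
  defines "T \<equiv> \<lambda>q. cscale \<i> (lie_bracket V L Lb q)" and "T' \<equiv> \<lambda>q. cscale \<i> (lie_bracket V L' Lb' q)"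
  defines "S \<equiv> lie_bracket V L T" and "S' \<equiv> lie_bracket V L' T'"
  defines "R \<equiv> lie_bracket V L S" and "R' \<equiv> lie_bracket V L' S'"
  assumes L: "tangent_field 3 L" and a: "Ck_within 3 V a"
    and L': "\<And>q. q \<in> V \<Longrightarrow> L' q = cscale (a q) (L q)" and p: "p \<in> V"
  shows "\<exists>b c d e f g h k.
    T' p = cscale b (L p) + cscale (cnj b) (Lb p) + cscale (a p * cnj (a p)) (T p) \<and>
    S' p = cscale e (L p) + cscale d (Lb p) + cscale c (T p) + cscale (a p * a p * cnj (a p)) (S p) \<and>
    R' p = cscale k (L p) + cscale h (Lb p) + cscale g (T p) + cscale f (S p)
      + cscale (a p * a p * a p * cnj (a p)) (R p)"
proof -
  have Lb: "tangent_field 3 Lb" unfolding Lb_def by (rule tangent_field_cconj[OF L])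
  have T: "tangent_field 2 T"
    unfolding T_def
    by (intro tangent_field_scale Ck_within_const tangent_field_lie_bracket) (use L Lb in \<open>simp_all add: eval_nat_numeral\<close>)
  have S: "tangent_field 1 S"
    unfolding S_def
    by (intro tangent_field_lie_bracket tangent_field_mono[OF L] tangent_field_mono[OF T]) auto
  have L1: "tangent_field 1 L" and Lb1: "tangent_field 1 Lb" and T1: "tangent_field 1 T" and a1: "Ck_within 1 V a"
    using tangent_field_mono[OF L] tangent_field_mono[OF Lb] tangent_field_mono[OF T] Ck_within_mono[OF a] by simp_all
  have LLb: "lie_bracket V L Lb q = cscale (- \<i>) (T q)" for q
    unfolding T_def by (simp add: cvec.scale_one)
  \<comment> \<open>The coefficient of \<open>L\<close> in \<open>\<i>\<close> times the bracket of
    \<open>a L\<close> with \<open>cnj a Lb\<close>. That of \<open>Lb\<close> is its conjugate,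
    since \<open>L (cnj a)\<close> is the conjugate of \<open>Lb (a)\<close>.\<close>
  define b where "b q = - \<i> * (cnj (a q) * cderiv_fun V a q (Lb q))" for q
  have b: "Ck_within 2 V b"
    unfolding b_def
    by (intro Ck_within_mult Ck_within_const Ck_within_cnj Ck_within_mono[OF a] Ck_within_cderiv_fun
        tangent_field_mono[OF Lb]) (use a in \<open>simp_all add: eval_nat_numeral\<close>)
  have b1: "Ck_within 1 V b" and cb1: "Ck_within 1 V (\<lambda>q. cnj (b q))" and ca1: "Ck_within 1 V (\<lambda>q. cnj (a q))"
    using Ck_within_mono[OF b, of 1] Ck_within_cnj a1 by auto
  have T': "T' q = cscale (b q) (L q) + cscale (cnj (b q)) (Lb q) + cscale (a q * cnj (a q)) (T q)"
    if q: "q \<in> V" for q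
  proof -
    have "T' q = cscale \<i> (lie_bracket V (\<lambda>q. cscale (a q) (L q)) (\<lambda>q. cscale (cnj (a q)) (Lb q)) q)"
      unfolding T'_def Lb'_def Lb_def
      by (intro arg_cong[of _ _ "cscale \<i>"] lie_bracket_cong q) (simp_all add: L' cconj_cscale)
    also have "\<dots> = cscale \<i> (cscale (a q * cnj (a q)) (lie_bracket V L Lb q)
        + cscale (a q * cnj (cderiv_fun V a q (Lb q))) (Lb q) - cscale (cnj (a q) * cderiv_fun V a q (Lb q)) (L q))"
      using lie_bracket_scale_scale[OF L1 Lb1 a1 ca1 q] cderiv_fun_cnj[OF a1 q tangent_fieldD(2)[OF L1 q]]
      by (simp add: Lb_def)
    also have "\<dots> = cscale (b q) (L q) + cscale (cnj (b q)) (Lb q) + cscale (a q * cnj (a q)) (T q)"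
      by (simp add: b_def T_def cvec.scale_right_distrib cvec.scale_right_diff_distrib mult_ac)
    finally show ?thesis .
  qed
  \<comment> \<open>\<open>X q Z\<close> is the derivative of \<open>a\<close> along
    \<open>Z\<close>, and \<open>Lf f\<close> the derivative of \<open>f\<close> along
    \<open>L\<close>.\<close>
  define X where "X q Z = cderiv_fun V a q (Z q)" for q and Z :: "'a \<Rightarrow> 'a \<times> 'a"
  define Lf where "Lf f q = cderiv_fun V f q (L q)" for f q
  note bracket = lie_bracket_scale_scale[OF L1 _ a1 _, folded Lf_def X_def]
  have C: "tangent_field 1 (\<lambda>q. cscale (a q) (L q))"
    by (intro tangent_field_scale a1 L1)
  define aa where "aa q = a q * cnj (a q)" for q
  \<comment> \<open>Every bracket with \<open>a L\<close> sends a term to \<open>L\<close>, and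
    \<open>e\<close> collects them. The last term of \<open>c\<close> comes from the bracket of
    \<open>L\<close> with \<open>Lb\<close>, which is \<open>- \<i> T\<close>.\<close>
  define e where "e q = a q * Lf b q - b q * X q L - cnj (b q) * X q Lb - aa q * X q T" for q
  define d where "d q = a q * Lf (\<lambda>q. cnj (b q)) q" for q
  define c where "c q = a q * Lf aa q - \<i> * (a q * cnj (b q))" for q
  have aa: "Ck_within 3 V aa" unfolding aa_def by (intro Ck_within_mult Ck_within_cnj a)
  have aa1: "Ck_within 1 V aa" using Ck_within_mono[OF aa] by simp
  have S': "S' q = cscale (e q) (L q) + cscale (d q) (Lb q) + cscale (c q) (T q) + cscale (a q * aa q) (S q)"
    if q: "q \<in> V" for q
  proof -
    have "S' q = lie_bracket V (\<lambda>q. cscale (a q) (L q))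
       (\<lambda>q. cscale (b q) (L q) + cscale (cnj (b q)) (Lb q) + cscale (aa q) (T q)) q"
      unfolding S'_def by (intro lie_bracket_cong q) (simp_all add: L' T' aa_def)
    also have "\<dots> = lie_bracket V (\<lambda>q. cscale (a q) (L q)) (\<lambda>q. cscale (b q) (L q)) q
      + lie_bracket V (\<lambda>q. cscale (a q) (L q)) (\<lambda>q. cscale (cnj (b q)) (Lb q)) q
      + lie_bracket V (\<lambda>q. cscale (a q) (L q)) (\<lambda>q. cscale (aa q) (T q)) q"
      using q by (simp only: lie_bracket_add_right[OF C] tangent_field_add tangent_field_scale b1 cb1 aa1 L1 Lb1 T1)
    also have "\<dots> = cscale (e q) (L q) + cscale (d q) (Lb q) + cscale (c q) (T q) + cscale (a q * aa q) (S q)"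
      unfolding bracket[OF L1 b1 q] bracket[OF Lb1 cb1 q] bracket[OF T1 aa1 q] LLb S_def[symmetric]
      by (simp add: c_def d_def e_def cvec.scale_left_distrib cvec.scale_left_diff_distrib algebra_simps)
    finally show ?thesis .
  qed
  have LfC: "Ck_within 1 V (Lf f)" if "Ck_within 2 V f" for f
    unfolding Lf_def using that L1 by (intro Ck_within_cderiv_fun) (simp_all add: eval_nat_numeral)
  have XC: "Ck_within 1 V (\<lambda>q. X q Z)" if "tangent_field 1 Z" for Z
    unfolding X_def using Ck_within_mono[OF a, of 2] that
    by (intro Ck_within_cderiv_fun) (simp_all add: eval_nat_numeral)
  have e1: "Ck_within 1 V e" and d1: "Ck_within 1 V d" and c1: "Ck_within 1 V c"
    unfolding e_def d_def c_def
    by (intro Ck_within_diff Ck_within_mult Ck_within_const LfC XC a1 b1 cb1 aa1 L1 Lb1 T1 b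
        Ck_within_cnj[OF b] Ck_within_mono[OF aa]; simp)+
  have aaa1: "Ck_within 1 V (\<lambda>q. a q * aa q)" by (intro Ck_within_mult a1 aa1)
  have "R' p = lie_bracket V (\<lambda>q. cscale (a q) (L q))
     (\<lambda>q. cscale (e q) (L q) + cscale (d q) (Lb q) + cscale (c q) (T q) + cscale (a q * aa q) (S q)) p"
    unfolding R'_def by (intro lie_bracket_cong p) (simp_all add: L' S')
  also have "\<dots> = lie_bracket V (\<lambda>q. cscale (a q) (L q)) (\<lambda>q. cscale (e q) (L q)) p
    + lie_bracket V (\<lambda>q. cscale (a q) (L q)) (\<lambda>q. cscale (d q) (Lb q)) p
    + lie_bracket V (\<lambda>q. cscale (a q) (L q)) (\<lambda>q. cscale (c q) (T q)) p
    + lie_bracket V (\<lambda>q. cscale (a q) (L q)) (\<lambda>q. cscale (a q * aa q) (S q)) p"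
    using p by (simp only: lie_bracket_add_right[OF C] tangent_field_add tangent_field_scale e1 d1 c1 aaa1 L1 Lb1 T1 S)
  \<comment> \<open>As before; the bracket of \<open>L\<close> with \<open>T\<close> is
    \<open>S\<close>, which accounts for \<open>a p * c p\<close> in the coefficient of
    \<open>S\<close>.\<close>
  also have "\<dots> = cscale (a p * Lf e p - e p * X p L - d p * X p Lb - c p * X p T - a p * aa p * X p S) (L p)
    + cscale (a p * Lf d p) (Lb p) + cscale (a p * Lf c p - \<i> * (a p * d p)) (T p)
    + cscale (a p * c p + a p * Lf (\<lambda>q. a q * aa q) p) (S p) + cscale (a p * (a p * aa p)) (R p)"
    unfolding bracket[OF L1 e1 p] bracket[OF Lb1 d1 p] bracket[OF T1 c1 p] bracket[OF S aaa1 p] LLb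
      S_def[symmetric] R_def[symmetric]
    by (simp add: cvec.scale_left_distrib cvec.scale_left_diff_distrib algebra_simps)
  finally have R': "R' p = \<dots>" .
  show ?thesis
    using T'[OF p] S'[OF p] R' by (simp only: aa_def mult.assoc) blast
qed

end

section \<open>The matrix group\<close>

lemma exhaust_5: "x = 1 \<or> x = 2 \<or> x = 3 \<or> x = 4 \<or> x = 5" for x :: 5
proof (induct x)
  case (of_int z)
  \<comment> \<open>The value 0 is the case \<open>x = 5\<close>, as the two coincide in the index
    type.\<close>
  then have "z = 0 \<or> z = 1 \<or> z = 2 \<or> z = 3 \<or> z = 4" by fastforce
  then show ?case by auto
qed

lemma forall_5: "(\<forall>i::5. P i) \<longleftrightarrow> P 1 \<and> P 2 \<and> P 3 \<and> P 4 \<and> P 5"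
  by (metis exhaust_5)

lemma UNIV_5: "UNIV = {1, 2, 3, 4, 5::5}"
  using exhaust_5 by auto

lemma sum_5: "sum f (UNIV::5 set) = f 1 + f 2 + f 3 + f 4 + f 5"
  unfolding UNIV_5 by (simp add: ac_simps)

lemma vector_5 [simp]:
  "(vector [v, w, x, y, z] :: 'a::zero ^ 5) $ 1 = v"
  "(vector [v, w, x, y, z] :: 'a::zero ^ 5) $ 2 = w"
  "(vector [v, w, x, y, z] :: 'a::zero ^ 5) $ 3 = x"
  "(vector [v, w, x, y, z] :: 'a::zero ^ 5) $ 4 = y"
  "(vector [v, w, x, y, z] :: 'a::zero ^ 5) $ 5 = z"
  unfolding vector_def by simp_all

text \<open>Trades the parametrization for equations between entries, the form needed for products,
  for closedness and for the chart.\<close>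

lemma mem_G_III2_initial_iff:
  "A \<in> G_III2_initial \<longleftrightarrow> A$1$1 \<noteq> 0 \<and>
    A$1$2 = 0 \<and> A$1$3 = 0 \<and> A$1$4 = 0 \<and> A$1$5 = 0 \<and>
    A$2$1 = 0 \<and> A$2$2 = cnj (A$1$1) \<and> A$2$3 = 0 \<and> A$2$4 = 0 \<and> A$2$5 = 0 \<and>
    A$3$2 = cnj (A$3$1) \<and> A$3$3 = A$1$1 * cnj (A$1$1) \<and> A$3$4 = 0 \<and> A$3$5 = 0 \<and>
    A$4$4 = A$1$1 * A$1$1 * cnj (A$1$1) \<and> A$4$5 = 0 \<and>
    A$5$5 = A$1$1 * A$1$1 * A$1$1 * cnj (A$1$1)"
  (is "_ \<longleftrightarrow> ?R A")
proof
  show "A \<in> G_III2_initial \<Longrightarrow> ?R A" by (auto simp: G_III2_initial_def)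
  assume R: "?R A"
  then have "A = vector [
      vector [A$1$1, 0, 0, 0, 0],
      vector [0, cnj (A$1$1), 0, 0, 0],
      vector [A$3$1, cnj (A$3$1), A$1$1 * cnj (A$1$1), 0, 0],
      vector [A$4$1, A$4$2, A$4$3, A$1$1 * A$1$1 * cnj (A$1$1), 0],
      vector [A$5$1, A$5$2, A$5$3, A$5$4, A$1$1 * A$1$1 * A$1$1 * cnj (A$1$1)]]"
    by (simp add: vec_eq_iff forall_5)
  then show "A \<in> G_III2_initial"
    using R unfolding G_III2_initial_def mem_Collect_eq by blast
qed

lemma matrix_mult_5: "(A ** B) $ i $ j
    = A$i$1 * B$1$j + A$i$2 * B$2$j + A$i$3 * B$3$j + A$i$4 * B$4$j + A$i$5 * B$5$j"
  for A B :: "'a::semiring_1 ^ 5 ^ 5"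
  by (simp add: matrix_matrix_mult_def sum_5)

text \<open>The conjugation in the third row survives because the diagonal entry
  \<open>a * cnj a\<close> is real.\<close>

lemma G_III2_initial_mult: "A \<in> G_III2_initial \<Longrightarrow> B \<in> G_III2_initial \<Longrightarrow> A ** B \<in> G_III2_initial"
  unfolding mem_G_III2_initial_iff matrix_mult_5 by (elim conjE) (simp add: mult_ac)

text \<open>The inverse of a lower triangular matrix by substitution; its third row is again of the
  right shape because \<open>p\<close> is real.\<close>

lemma G_III2_initial_inverse:
  assumes "A \<in> G_III2_initial"
  shows "\<exists>B \<in> G_III2_initial. B ** A = mat 1 \<and> A ** B = mat 1"
proof -
  from assms obtain a b c d e f g h k where a: "a \<noteq> 0" and A: "A = vector [
      vector [a, 0, 0, 0, 0],
      vector [0, cnj a, 0, 0, 0],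
      vector [b, cnj b, a * cnj a, 0, 0],
      vector [e, d, c, a * a * cnj a, 0],
      vector [k, h, g, f, a * a * a * cnj a]]"
    unfolding G_III2_initial_def by blast
  define p where "p = inverse a * cnj (inverse a)"
  define q where "q = inverse a * inverse a * cnj (inverse a)"
  define r where "r = inverse a * inverse a * inverse a * cnj (inverse a)"
  \<comment> \<open>Each definition solves one equation below the diagonal of
    \<open>B ** A = mat 1\<close>; within a row the entries are found from right to left.\<close>
  define b' where "b' = - p * b / a"
  define c' where "c' = - q * c / (a * cnj a)"
  define d' where "d' = - (c' * cnj b + q * d) / cnj a"
  define e' where "e' = - (c' * b + q * e) / a"
  define f' where "f' = - r * f / (a * a * cnj a)"
  define g' where "g' = - (f' * c + r * g) / (a * cnj a)"
  define h' where "h' = - (g' * cnj b + f' * d + r * h) / cnj a"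
  define k' where "k' = - (g' * b + f' * e + r * k) / a"
  define B :: "complex ^ 5 ^ 5" where "B = vector [
      vector [inverse a, 0, 0, 0, 0],
      vector [0, cnj (inverse a), 0, 0, 0],
      vector [b', cnj b', p, 0, 0],
      vector [e', d', c', q, 0],
      vector [k', h', g', f', r]]"
  have "B \<in> G_III2_initial"
    using a by (simp add: mem_G_III2_initial_iff B_def p_def q_def r_def)
  moreover have "B ** A = mat 1"
  proof -
    have 1: "p * (a * cnj a) = 1" "q * (a * a * cnj a) = 1" "r * (a * a * a * cnj a) = 1"
      using a by (simp_all add: p_def q_def r_def field_simps)
    have div: "y * z = x" if "y = x / z" "z \<noteq> 0" for x y z :: complex
      using that by simp
    note 2 = div[OF b'_def] div[OF c'_def] div[OF d'_def] div[OF e'_def] div[OF f'_def]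
      div[OF g'_def] div[OF h'_def] div[OF k'_def]
    \<comment> \<open>The equation of entry (3,2) is the conjugate of that of entry (3,1).\<close>
    have 3: "cnj b' * cnj a = - p * cnj b"
      using arg_cong[OF 2(1)[OF a], of cnj] by (simp add: p_def mult.commute)
    show ?thesis
      unfolding vec_eq_iff forall_5 matrix_mult_5 A B_def
      using a by (simp add: mat_def 1 2 3)
  qed
  ultimately show ?thesis using matrix_left_right_inverse by blast
qed

lemma group_GL: "group (GL :: (complex ^ 'n ^ 'n) monoid)"
proof (rule groupI)
  fix A :: "complex ^ 'n ^ 'n" assume "A \<in> carrier GL"
  then obtain B where "A ** B = mat 1" "B ** A = mat 1" by (auto simp: GL_def invertible_def)
  then show "\<exists>B\<in>carrier GL. B \<otimes>\<^bsub>GL\<^esub> A = \<one>\<^bsub>GL\<^esub>"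
    by (auto simp: GL_def invertible_def)
next
  have "invertible (mat 1 :: complex ^ 'n ^ 'n)"
    unfolding invertible_def by (intro exI[of _ "mat 1"]) simp
  then show "\<one>\<^bsub>GL\<^esub> \<in> carrier (GL :: (complex ^ 'n ^ 'n) monoid)" by (simp add: GL_def)
qed (auto simp: GL_def invertible_mult matrix_mul_assoc)

lemma subgroup_G_III2_initial: "subgroup G_III2_initial GL"
proof (rule group.subgroupI[OF group_GL])
  show sub: "G_III2_initial \<subseteq> carrier GL"
    using G_III2_initial_inverse by (force simp: GL_def invertible_def)
  have "mat 1 \<in> G_III2_initial" by (simp add: mem_G_III2_initial_iff mat_def)
  then show "G_III2_initial \<noteq> {}" by blast
  show "inv\<^bsub>GL\<^esub> A \<in> G_III2_initial" if A: "A \<in> G_III2_initial" for A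
  proof -
    obtain B where B: "B \<in> G_III2_initial" "B ** A = mat 1"
      using G_III2_initial_inverse[OF A] by blast
    then have "inv\<^bsub>GL\<^esub> A = B"
      using A sub by (intro group.inv_equality[OF group_GL]) (auto simp: GL_def)
    then show ?thesis using B by simp
  qed
qed (simp add: GL_def G_III2_initial_mult)

text \<open>The equations are closed conditions, but \<open>a \<noteq> 0\<close> is not. Within the
  invertible matrices it follows from them: the rest of the first row vanishes.\<close>

lemma closedin_G_III2_initial: "closedin (top_of_set (carrier GL)) G_III2_initial"
proof -
  define C :: "(complex ^ 5 ^ 5) set" where "C = {A.
    A$1$2 = 0 \<and> A$1$3 = 0 \<and> A$1$4 = 0 \<and> A$1$5 = 0 \<and>
    A$2$1 = 0 \<and> A$2$2 = cnj (A$1$1) \<and> A$2$3 = 0 \<and> A$2$4 = 0 \<and> A$2$5 = 0 \<and>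
    A$3$2 = cnj (A$3$1) \<and> A$3$3 = A$1$1 * cnj (A$1$1) \<and> A$3$4 = 0 \<and> A$3$5 = 0 \<and>
    A$4$4 = A$1$1 * A$1$1 * cnj (A$1$1) \<and> A$4$5 = 0 \<and>
    A$5$5 = A$1$1 * A$1$1 * A$1$1 * cnj (A$1$1)}"
  have "closed C"
    unfolding C_def by (intro closed_Collect_conj closed_Collect_eq continuous_intros)
  moreover have "G_III2_initial = carrier GL \<inter> C"
  proof (intro equalityI subsetI)
    fix A assume "A \<in> G_III2_initial"
    then show "A \<in> carrier GL \<inter> C"
      using subgroup.subset[OF subgroup_G_III2_initial] by (auto simp: mem_G_III2_initial_iff C_def)
  next
    fix A assume A: "A \<in> carrier GL \<inter> C"
    then obtain B where "A ** B = mat 1" by (auto simp: GL_def invertible_def)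
    then have "(A ** B) $ 1 $ 1 = 1" by (simp add: mat_def)
    then have "A$1$1 \<noteq> 0" using A by (auto simp: matrix_mult_5 C_def)
    then show "A \<in> G_III2_initial" using A by (simp add: mem_G_III2_initial_iff C_def)
  qed
  ultimately show ?thesis unfolding closedin_closed by blast
qed

text \<open>The last three diagonal entries are polynomials in \<open>a\<close> and
  \<open>cnj a\<close>, so the group is a graph over an open part of a real linear space with nine
  complex parameters, of real dimension 2 * 9 = 18. Subtracting these entries is a global
  chart.\<close>

lemma submanifold_G_III2_initial: "submanifold C_infinity 18 G_III2_initial"
proof -
  define E :: "5 \<Rightarrow> complex \<Rightarrow> complex ^ 5 ^ 5" where "E l z = (\<chi> i j. if i = l \<and> j = l then z else 0)" for l z
  \<comment> \<open>\<open>P A\<close> depends only on the entry (1,1) of \<open>A\<close>, which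
    adding or subtracting \<open>P A\<close> leaves alone; hence the two maps are inverse to each
    other.\<close>
  define P :: "complex ^ 5 ^ 5 \<Rightarrow> complex ^ 5 ^ 5" where
    "P A = E 3 (A$1$1 * cnj (A$1$1)) + E 4 (A$1$1 * A$1$1 * cnj (A$1$1))
      + E 5 (A$1$1 * A$1$1 * A$1$1 * cnj (A$1$1))" for A
  define U :: "(complex ^ 5 ^ 5) set" where "U = {A. A$1$1 \<noteq> 0}"
  \<comment> \<open>Parametrizes the flat model; it is linear over the reals only, because of the
    conjugated entries.\<close>
  define \<iota> :: "complex \<times> complex \<times> complex \<times> complex \<times> complex \<times> complex \<times> complex \<times> complex \<times> complex \<Rightarrow> complex ^ 5 ^ 5"
    where "\<iota> = (\<lambda>(a, b, c, d, e, f, g, h, k). vector [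
      vector [a, 0, 0, 0, 0],
      vector [0, cnj a, 0, 0, 0],
      vector [b, cnj b, 0, 0, 0],
      vector [e, d, c, 0, 0],
      vector [k, h, g, f, 0]])"
  have lin: "linear \<iota>"
    by (intro linearI) (auto simp: \<iota>_def vec_eq_iff forall_5)
  have inj: "inj \<iota>"
    by (auto simp: inj_on_def \<iota>_def vec_eq_iff forall_5)
  have "dim (range \<iota>) = dim (UNIV :: (complex \<times> complex \<times> complex \<times> complex \<times> complex \<times> complex \<times> complex \<times> complex \<times> complex) set)"
    using dim_image_eq[OF lin, of UNIV] inj by simp
  then have dim: "dim (range \<iota>) = 18" by simp
  have sub: "subspace (range \<iota>)" using linear_subspace_image[OF lin subspace_UNIV] .
  have range: "A \<in> range \<iota> \<longleftrightarrow> A$1$2 = 0 \<and> A$1$3 = 0 \<and> A$1$4 = 0 \<and> A$1$5 = 0 \<and>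
    A$2$1 = 0 \<and> A$2$2 = cnj (A$1$1) \<and> A$2$3 = 0 \<and> A$2$4 = 0 \<and> A$2$5 = 0 \<and>
    A$3$2 = cnj (A$3$1) \<and> A$3$3 = 0 \<and> A$3$4 = 0 \<and> A$3$5 = 0 \<and>
    A$4$4 = 0 \<and> A$4$5 = 0 \<and> A$5$5 = 0" (is "_ \<longleftrightarrow> ?R A") for A
  proof
    show "A \<in> range \<iota> \<Longrightarrow> ?R A" by (auto simp: \<iota>_def)
    assume "?R A"
    then have "A = \<iota> (A$1$1, A$3$1, A$4$3, A$4$2, A$4$1, A$5$4, A$5$3, A$5$2, A$5$1)"
      by (simp add: \<iota>_def vec_eq_iff forall_5)
    then show "A \<in> range \<iota>" by blast
  qed
  have U: "open U" unfolding U_def by (intro open_Collect_neq continuous_intros)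
  have entry: "Ck_on n U (\<lambda>A. A$1$1)" for n
    by (intro Ck_on_bounded_linear[OF bounded_linear_vec_nth] Ck_on_id U)
  have linE: "bounded_linear (E l)" for l
    by (rule linear_conv_bounded_linear[THEN iffD1]) (auto simp: E_def vec_eq_iff intro!: linearI)
  have smooth_P: "Ck_on n U P" for n
    unfolding P_def
    by (intro Ck_on_add Ck_on_bounded_linear[OF linE] Ck_on_bilinear[OF bounded_bilinear_mult]
        Ck_on_bounded_linear[OF bounded_linear_cnj] entry U)
  then have plus: "Ck_on n U (\<lambda>A. A + P A)" for n
    by (intro Ck_on_add Ck_on_id U)
  have "Ck_on n U (\<lambda>A. - P A)" for n
    by (intro Ck_on_bounded_linear[OF bounded_linear_minus[OF bounded_linear_ident]] smooth_P U)
  from Ck_on_add[OF U Ck_on_id[OF U] this] have minus: "Ck_on n U (\<lambda>A. A - P A)" for n by simp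
  have P11: "P A $ 1 $ 1 = 0" for A
    by (simp add: P_def E_def)
  then have entry_P: "(A + P A)$1$1 = A$1$1" "(A - P A)$1$1 = A$1$1" for A
    by simp_all
  have P_cong: "A$1$1 = B$1$1 \<Longrightarrow> P A = P B" for A B by (simp add: P_def)
  have inverses: "(A + P A) - P (A + P A) = A" "(A - P A) + P (A - P A) = A" for A
    using P_cong[of "A + P A" A] P_cong[of "A - P A" A] entry_P by simp_all
  have hom: "homeomorphism U U (\<lambda>A. A - P A) (\<lambda>A. A + P A)"
    using plus[of 0] minus[of 0] inverses by (intro homeomorphismI) (auto simp: U_def P11)
  have G: "A + P A \<in> G_III2_initial \<longleftrightarrow> A \<in> U \<inter> range \<iota>" for A
    unfolding mem_G_III2_initial_iff range Int_iff U_def mem_Collect_eq entry_P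
    by (simp add: P_def E_def)
  have GU: "G_III2_initial \<subseteq> U" by (auto simp: mem_G_III2_initial_iff U_def)
  have "(\<lambda>A. A - P A) ` (G_III2_initial \<inter> U) = U \<inter> range \<iota>"
  proof (intro equalityI subsetI)
    fix B assume "B \<in> (\<lambda>A. A - P A) ` (G_III2_initial \<inter> U)"
    then obtain A where "A \<in> G_III2_initial" "B = A - P A" by blast
    then show "B \<in> U \<inter> range \<iota>" using G[of B] inverses(2)[of A] by simp
  next
    fix B assume "B \<in> U \<inter> range \<iota>"
    then have "B + P B \<in> G_III2_initial \<inter> U" using G GU by blast
    then show "B \<in> (\<lambda>A. A - P A) ` (G_III2_initial \<inter> U)"
      using inverses(1)[of B] by (intro image_eqI[of _ _ "B + P B"]) simp_all
  qed
  then show ?thesis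
    unfolding submanifold_def of_class.simps using U hom plus minus sub dim subsetD[OF GU]
    by (intro ballI exI[of _ U] exI[of _ "\<lambda>A. A - P A"] exI[of _ "\<lambda>A. A + P A"] exI[of _ "range \<iota>"] conjI allI)
qed

section \<open>Frames and the bundle of vectors of type (1,0)\<close>

lemma of_class_imp_Ck_on:
  assumes "of_class s U f" "\<And>\<kappa>. s = C_fin \<kappa> \<Longrightarrow> k \<le> \<kappa>"
  shows "Ck_on k U f"
  using assms by (cases s) (auto intro: Ck_on_mono)

lemma submanifold_imp_Ck:
  fixes M :: "'a::euclidean_space set"
  assumes "submanifold s d M" "\<And>\<kappa>. s = C_fin \<kappa> \<Longrightarrow> k \<le> \<kappa>"
  shows "submanifold (C_fin k) d M"
proof -
  have *: "of_class s U f \<Longrightarrow> of_class (C_fin k) U f" for U and f :: "'a \<Rightarrow> 'a"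
    using of_class_imp_Ck_on assms(2) by auto
  show ?thesis
    unfolding submanifold_def
    by (rule ballI, drule bspec[OF assms(1)[unfolded submanifold_def]]) (elim ex_forward, elim conjE, intro conjI; (assumption | erule *))
qed

lemma local_generator_Ck:
  assumes "local_generator s M V L" "\<And>\<kappa>. s = C_fin \<kappa> \<Longrightarrow> Suc k \<le> \<kappa>"
  shows "Ck_within k V L"
proof -
  have "k \<le> \<kappa>" if "bundle_class s = C_fin \<kappa>" for \<kappa>
    using that assms(2) by (cases s) auto
  then show ?thesis
    using assms(1) of_class_imp_Ck_on[of "bundle_class s"] unfolding local_generator_def of_class_within_def of_class.simps
    by metis
qed

section \<open>Linear algebra in the complexification\<close>

text \<open>A span of dimension at least the number of its generators leaves no room for repetitions
  or relations. Injectivity is separate, since \<open>range\<close> forgets repetitions.\<close>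

lemma cvec_family_independent:
  fixes F :: "('a::real_vector \<times> 'a) ^ 'n"
  assumes X: "X \<subseteq> cvec.span (range (($) F))" and dim: "cvec.dim X = CARD('n)"
  shows "inj (($) F)" and "cvec.independent (range (($) F))"
proof -
  obtain B where B: "B \<subseteq> range (($) F)" "cvec.independent B" "range (($) F) \<subseteq> cvec.span B"
    using cvec.basis_exists[of "range (($) F)"] by metis
  have fin: "finite (range (($) F))" by simp
  have "X \<subseteq> cvec.span B"
    using X B(3) cvec.span_minimal[OF B(3) cvec.subspace_span] by blast
  then have "CARD('n) \<le> card B"
    using cvec.dim_le_card dim finite_subset[OF B(1) fin] by metis
  moreover have "card B \<le> card (range (($) F))" using card_mono[OF fin B(1)] .
  moreover have "card (range (($) F)) \<le> CARD('n)" by (simp add: card_image_le)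
  ultimately have eq: "card B = card (range (($) F))" "card (range (($) F)) = CARD('n)" by linarith+
  show "inj (($) F)" using eq(2) by (simp add: eq_card_imp_inj_on)
  show "cvec.independent (range (($) F))" using card_subset_eq[OF fin B(1) eq(1)] B(2) by simp
qed

text \<open>A real basis of \<open>T\<close> spans \<open>T \<times> T\<close> over the complex
  numbers, so an independent family of that size cannot be enlarged inside
  \<open>T \<times> T\<close>.\<close>

lemma cspan_complexified_subspace:
  fixes T :: "'a::euclidean_space set"
  assumes T: "subspace T" and F: "\<And>i. F $ i \<in> T \<times> T" "cvec.independent (range (($) F))" "inj (($) F)"
    and dim: "dim T = CARD('n)"
  shows "cvec.span (range (($) (F :: ('a \<times> 'a) ^ 'n))) = T \<times> T"
proof
  have sub: "cvec.subspace (T \<times> T)"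
    using T by (auto simp: cvec.subspace_def cscale_def subspace_0 zero_prod_def
        intro!: subspace_add subspace_diff subspace_scale)
  show "cvec.span (range (($) F)) \<subseteq> T \<times> T"
    using F(1) by (intro cvec.span_minimal sub) (simp add: image_subset_iff)
  obtain b where b: "b \<subseteq> T" "independent b" "T \<subseteq> span b" "card b = dim T"
    using basis_exists[of T] by metis
  define W where "W = (\<lambda>v. (v, 0 :: 'a)) ` b"
  have fin: "finite W" using independent_imp_finite[OF b(2)] by (simp add: W_def)
  have card_W: "card W = CARD('n)"
    unfolding W_def using b(4) dim by (subst card_image) (auto simp: inj_on_def)
  have *: "(u, 0) \<in> cvec.span W" if "u \<in> T" for u
  proof -
    have "subspace {u. (u, 0 :: 'a) \<in> cvec.span W}"
    proof (rule subspaceI)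
      show "0 \<in> {u. (u, 0 :: 'a) \<in> cvec.span W}" using cvec.span_zero[of W] by (simp add: zero_prod_def)
    next
      fix x y assume "x \<in> {u. (u, 0 :: 'a) \<in> cvec.span W}" "y \<in> {u. (u, 0 :: 'a) \<in> cvec.span W}"
      then show "x + y \<in> {u. (u, 0 :: 'a) \<in> cvec.span W}"
        using cvec.span_add[of "(x, 0)" W "(y, 0)"] by simp
    next
      fix c x assume "x \<in> {u. (u, 0 :: 'a) \<in> cvec.span W}"
      then show "c *\<^sub>R x \<in> {u. (u, 0 :: 'a) \<in> cvec.span W}"
        using cvec.span_scale[of "(x, 0)" W "of_real c"] by (simp add: cscale_def)
    qed
    moreover have "b \<subseteq> {u. (u, 0 :: 'a) \<in> cvec.span W}"
      unfolding W_def by (auto intro: cvec.span_base)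
    ultimately have "span b \<subseteq> {u. (u, 0 :: 'a) \<in> cvec.span W}" using span_minimal by blast
    then show ?thesis using that b(3) by blast
  qed
  have TW: "T \<times> T \<subseteq> cvec.span W"
  proof
    fix w assume "w \<in> T \<times> T"
    then have "(fst w, 0) + cscale \<i> (snd w, 0) \<in> cvec.span W"
      using * by (intro cvec.span_add cvec.span_scale) auto
    then show "w \<in> cvec.span W" by (simp add: cscale_def)
  qed
  have card_F: "card (range (($) F)) = CARD('n)" using card_image[OF F(3)] .
  show "T \<times> T \<subseteq> cvec.span (range (($) F))"
  proof (rule ccontr)
    assume "\<not> T \<times> T \<subseteq> cvec.span (range (($) F))"
    then obtain w where w: "w \<in> T \<times> T" "w \<notin> cvec.span (range (($) F))" by blast
    then have "cvec.independent (insert w (range (($) F)))"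
      using F(2) cvec.independent_insert by metis
    moreover have "insert w (range (($) F)) \<subseteq> cvec.span W" using F(1) w(1) TW by blast
    ultimately have "card (insert w (range (($) F))) \<le> CARD('n)"
      using cvec.independent_span_bound[OF fin] card_W by metis
    moreover have "w \<notin> range (($) F)" using w(2) cvec.span_base by metis
    ultimately show False by (simp add: card_F)
  qed
qed

section \<open>The line of vectors of type (1,0)\<close>

lemma linear_J: "linear (J :: complex ^ 'n \<Rightarrow> complex ^ 'n)"
  by (auto simp: J_def vec_eq_iff algebra_simps intro!: linearI)

lemma J_J: "J (J u) = - u"
  by (simp add: J_def vec_eq_iff flip: mult.assoc)

lemma J_minus: "J (- u) = - J u"
  by (rule linear_neg[OF linear_J])

text \<open>Vectors of type (1,0) are those of the form \<open>u - i J u\<close>, so the real part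
  determines them. The eigenvalue equation gives two real equations, of which one implies the other
  since \<open>J\<close> squares to -1.\<close>

lemma T10_iff: "w \<in> T10 M p \<longleftrightarrow> fst w \<in> tangent_space M p \<and> snd w \<in> tangent_space M p \<and> snd w = - J (fst w)"
proof -
  have "J v = u" if "v = - J u" for u v :: "complex ^ 'n"
    using that by (simp add: J_minus J_J)
  then show ?thesis
    by (cases w) (auto simp: T10_def ctangent_space_def cscale_def)
qed

lemma T10_line:
  fixes M :: "(complex ^ 'n) set"
  assumes T: "subspace (tangent_space M p)" "2 * dim (tangent_space M p) = DIM(complex ^ 'n) + 2"
    and gen: "{u + J v | u v. u \<in> tangent_space M p \<and> v \<in> tangent_space M p} = UNIV"
    and w: "w \<in> T10 M p" "w \<noteq> 0" and w': "w' \<in> T10 M p"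
  obtains c where "w' = cscale c w"
proof -
  let ?T = "tangent_space M p"
  have JT: "subspace (J ` ?T)" using linear_subspace_image[OF linear_J T(1)] .
  have "inj J" using J_J by (metis injI neg_equal_iff_equal)
  then have dJT: "dim (J ` ?T) = dim ?T"
    using dim_image_eq[OF linear_J] by (metis inj_on_subset subset_UNIV)
  have "{x + y |x y. x \<in> ?T \<and> y \<in> J ` ?T} = UNIV"
    using gen by blast
  then have dim2: "dim (?T \<inter> J ` ?T) = 2"
    using dim_sums_Int[OF T(1) JT] dJT T(2) by simp
  have mem: "fst w \<in> ?T \<inter> J ` ?T" "J (fst w) \<in> ?T \<inter> J ` ?T" if w: "w \<in> T10 M p" for w
  proof -
    have "fst w \<in> ?T" "- J (fst w) \<in> ?T" using w by (auto simp: T10_iff)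
    then have 1: "fst w \<in> ?T" "J (fst w) \<in> ?T" using subspace_neg[OF T(1)] by fastforce+
    moreover have "fst w = J (- J (fst w))" by (simp add: J_minus J_J)
    ultimately show "fst w \<in> ?T \<inter> J ` ?T" "J (fst w) \<in> ?T \<inter> J ` ?T"
      using \<open>- J (fst w) \<in> ?T\<close> by blast+
  qed
  define u where "u = fst w"
  have "snd w = - J u" using w by (simp add: T10_iff u_def)
  then have u: "u \<noteq> 0" using w(2) linear_0[OF linear_J] by (auto simp: u_def prod_eq_iff)
  then obtain i where i: "u $ i \<noteq> 0" by (auto simp: vec_eq_iff)
  \<comment> \<open>A nonzero component of \<open>u\<close> would otherwise make \<open>\<i>\<close>
    real.\<close>
  have ind: "J u \<notin> span {u}"
  proof
    assume "J u \<in> span {u}"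
    then obtain r where "J u = r *\<^sub>R u" by (auto simp: span_singleton)
    then have "J u $ i = (r *\<^sub>R u) $ i" by simp
    then have "\<i> * u $ i = r *\<^sub>R u $ i" by (simp add: J_def)
    then have "\<i> = complex_of_real r" using i by (simp add: scaleR_conv_of_real)
    then show False by (simp add: complex_eq_iff)
  qed
  then have "J u \<noteq> u" using span_base[of u "{u}"] by auto
  moreover have "independent {J u, u}"
    using ind u by (simp add: independent_insert)
  ultimately have d2: "dim {J u, u} = 2"
    by (simp add: dim_eq_card_independent)
  have "span {J u, u} = ?T \<inter> J ` ?T"
  proof (rule subspace_dim_equal)
    show "span {J u, u} \<subseteq> ?T \<inter> J ` ?T"
      using mem[OF w(1)] by (intro span_minimal subspace_inter T(1) JT) (auto simp: u_def)
  qed (use d2 dim2 in \<open>auto intro: subspace_inter T(1) JT\<close>)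
  then have "fst w' \<in> span {J u, u}" using mem[OF w'] by blast
  then obtain y where "fst w' - y *\<^sub>R J u \<in> span {u}" by (auto simp: span_insert)
  then obtain x where "fst w' - y *\<^sub>R J u = x *\<^sub>R u" by (auto simp: span_singleton)
  then have f: "fst w' = x *\<^sub>R u + y *\<^sub>R J u" by (simp add: algebra_simps)
  have "snd w' = - J (fst w')" using w' by (simp add: T10_iff)
  also have "\<dots> = y *\<^sub>R u - x *\<^sub>R J u"
    by (simp add: f linear_add[OF linear_J] linear_scale[OF linear_J] J_J)
  \<comment> \<open>The real part of \<open>(x + i y) (u - i J u)\<close> is
    \<open>x u + y J u\<close>, which identifies the factor.\<close>
  finally have "w' = cscale (Complex x y) w"
    using f \<open>snd w = - J u\<close> by (simp add: prod_eq_iff fst_cscale snd_cscale u_def)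
  then show ?thesis by (rule that)
qed

text \<open>On vectors of type (1,0) the formal imaginary unit acts on the real part as
  \<open>J\<close>, that is, as multiplication by \<open>\<i>\<close>. The factor between two
  generators thus becomes a quotient of ordinary complex functions.\<close>

lemma T10_cscale_component:
  assumes "w \<in> T10 M p"
  shows "fst (cscale c w) $ i = c * fst w $ i"
  using assms by (simp add: T10_iff fst_cscale J_def complex_eq_iff algebra_simps)

lemma Ck_within_T10_coefficient:
  fixes L L' :: "complex ^ 'n \<Rightarrow> (complex ^ 'n) \<times> (complex ^ 'n)"
  assumes L: "Ck_within k V L" "\<And>q. q \<in> V \<Longrightarrow> L q \<in> T10 M q" "\<And>q. q \<in> V \<Longrightarrow> L q \<noteq> 0"
    and L': "Ck_within k V L'" and a: "\<And>q. q \<in> V \<Longrightarrow> L' q = cscale (a q) (L q)"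
  shows "Ck_within k V a"
proof (rule Ck_within_divide_locally)
  fix p assume p: "p \<in> V"
  have "fst (L p) \<noteq> 0"
    using L(2,3)[OF p] linear_0[OF linear_J] by (auto simp: T10_iff prod_eq_iff)
  then obtain i where i: "fst (L p) $ i \<noteq> 0" by (auto simp: vec_eq_iff)
  have comp: "Ck_within k V (\<lambda>q. fst (X q) $ i)" if "Ck_within k V X" for X :: "complex ^ 'n \<Rightarrow> (complex ^ 'n) \<times> (complex ^ 'n)"
    by (intro Ck_within_bounded_linear[OF bounded_linear_vec_nth] Ck_within_bounded_linear[OF bounded_linear_fst] that)
  show "\<exists>f g. Ck_within k V f \<and> Ck_within k V g \<and> g p \<noteq> 0 \<and> (\<forall>x\<in>V. f x = a x * g x)"
    using comp[OF L'] comp[OF L(1)] i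
    by (rule_tac exI[of _ "\<lambda>q. fst (L' q) $ i"], rule_tac exI[of _ "\<lambda>q. fst (L q) $ i"])
      (simp add: a T10_cscale_component[OF L(2)])
qed

section \<open>The frame as a basis, and the frames of two generators compared\<close>

theorem mainTheorem4:
  fixes M :: "(complex ^ 4) set" and s :: smoothness
  assumes "\<And>\<kappa>. s = C_fin \<kappa> \<Longrightarrow> 4 \<le> \<kappa>"
    and "submanifold s 5 M"
    and "connected M"
    and "cr_generic M"
    and "general_class_III2 s M"
  shows "(\<forall>V L. local_generator s M V L \<longrightarrow>
            (\<forall>p\<in>V. is_basis (frame_III2 V L p) (ctangent_space M p))) \<and>
         performs_reduction s M frame_III2 G_III2_initial \<and>
         submanifold C_infinity 18 G_III2_initial"
proof -
  have patch: "submanifold_patch M V 5" if "local_generator s M V L" for V L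
    using submanifold_imp_Ck[OF assms(2), of 2] assms(1) that
    by unfold_locales (fastforce simp: local_generator_def)+
  have field: "submanifold_patch.tangent_field M V 3 L" if gen: "local_generator s M V L" for V L
    using local_generator_Ck[OF gen, of 3] assms(1) gen
    by (fastforce simp: submanifold_patch.tangent_field_def[OF patch[OF gen]] local_generator_def T10_def)
  have basis: "is_basis (frame_III2 V L p) (ctangent_space M p)"
    if gen: "local_generator s M V L" and p: "p \<in> V" for V L p
  proof -
    interpret submanifold_patch M V 5 by (rule patch[OF gen])
    define Lb where "Lb = (\<lambda>p. cconj (L p))"
    define B where "B = lie_bracket V L Lb"
    define T where "T = (\<lambda>q. cscale \<i> (B q))"
    define S where "S = lie_bracket V L T"
    define R where "R = lie_bracket V L S"
    have L: "tangent_field 3 L" by (rule field[OF gen])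
    have Lb: "tangent_field 3 Lb" unfolding Lb_def by (rule tangent_field_cconj[OF L])
    have B: "tangent_field 2 B"
      unfolding B_def by (rule tangent_field_lie_bracket) (use L Lb in \<open>simp_all add: eval_nat_numeral\<close>)
    have T: "tangent_field 2 T"
      unfolding T_def by (intro tangent_field_scale Ck_within_const B)
    have LB: "tangent_field 1 (lie_bracket V L B)" and S: "tangent_field 1 S"
      unfolding S_def using tangent_field_mono[OF L, of 2] B T
      by (auto intro!: tangent_field_lie_bracket simp: eval_nat_numeral)
    have L1: "tangent_field 1 L" and B1: "tangent_field 1 B"
      using tangent_field_mono[OF L] tangent_field_mono[OF B] by simp_all
    \<comment> \<open>The rank condition iterates brackets of \<open>B\<close>, the frame those of
      \<open>T\<close>, which is \<open>\<i>\<close> times \<open>B\<close>; only constant factors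
      separate them.\<close>
    have S_eq: "S q = cscale \<i> (lie_bracket V L B q)" if "q \<in> V" for q
      unfolding S_def T_def by (rule lie_bracket_const_scale[OF L1 B1 that])
    have R_eq: "R p = cscale \<i> (lie_bracket V L (lie_bracket V L B) p)"
    proof -
      have "R p = lie_bracket V L (\<lambda>q. cscale \<i> (lie_bracket V L B q)) p"
        unfolding R_def by (rule lie_bracket_cong[OF p refl S_eq])
      also have "\<dots> = cscale \<i> (lie_bracket V L (lie_bracket V L B) p)"
        by (rule lie_bracket_const_scale[OF L1 LB p])
      finally show ?thesis .
    qed
    define F where "F = frame_III2 V L p"
    have F: "F $ 1 = L p" "F $ 2 = Lb p" "F $ 3 = T p" "F $ 4 = S p" "F $ 5 = R p"
      by (simp_all add: F_def frame_III2_def Let_def Lb_def B_def T_def S_def R_def)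
    let ?X = "{L p, Lb p, B p, lie_bracket V L B p, lie_bracket V L (lie_bracket V L B) p}"
    have dim: "cvec.dim ?X = CARD(5)"
      using assms(5)[unfolded general_class_III2_def, rule_format, OF gen] p
      by (simp add: Let_def Lb_def B_def)
    have span: "cscale c (F $ i) \<in> cvec.span (range (($) F))" for c i
      by (intro cvec.span_scale cvec.span_base) simp
    have "cscale (- \<i>) (cscale \<i> v) = v" for v :: "(complex ^ 4) \<times> (complex ^ 4)" by simp
    then have "?X \<subseteq> cvec.span (range (($) F))"
      using span[of 1 1] span[of 1 2] span[of "- \<i>" 3] span[of "- \<i>" 4] span[of "- \<i>" 5]
      unfolding F S_eq[OF p] R_eq T_def by simp
    note ind = cvec_family_independent[OF this dim]
    \<comment> \<open>\<open>R\<close> is only continuous, but its tangency needs just one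
      derivative of \<open>L\<close> and \<open>S\<close>.\<close>
    have FT: "F $ i \<in> tangent_space M p \<times> tangent_space M p" for i
    proof -
      have "\<forall>i. F $ i \<in> ctangent_space M p"
        unfolding forall_5 F R_def
        using tangent_fieldD(2)[OF L p] tangent_fieldD(2)[OF Lb p] tangent_fieldD(2)[OF T p]
          tangent_fieldD(2)[OF S p] lie_bracket_ctangent[OF L1 S p] by simp
      then show ?thesis by (simp add: ctangent_space_def)
    qed
    show ?thesis
      using ind cspan_complexified_subspace[OF subspace_tangent[OF p] FT ind(2,1)] dim_tangent[OF p]
      by (simp add: is_basis_def F_def ctangent_space_def)
  qed
  have reduction: "\<exists>g. \<forall>p\<in>V. g p \<in> G_III2_initial \<and> frame_III2 V L' p = frame_mult (g p) (frame_III2 V L p)"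
    if gen: "local_generator s M V L" and gen': "local_generator s M V L'" for V L L'
  proof -
    interpret submanifold_patch M V 5 by (rule patch[OF gen])
    have VM: "V \<subseteq> M" using openin_imp_subset[OF openin_V] .
    have T10: "L q \<in> T10 M q" "L q \<noteq> 0" "L' q \<in> T10 M q" "L' q \<noteq> 0" if "q \<in> V" for q
      using gen gen' that by (auto simp: local_generator_def)
    have "\<exists>c. L' q = cscale c (L q)" if q: "q \<in> V" for q
    proof -
      \<comment> \<open>The count 2 * 5 = 8 + 2 in real dimensions.\<close>
      have "2 * dim (tangent_space M q) = DIM(complex ^ 4) + 2" using dim_tangent[OF q] by simp
      moreover have "{u + J v | u v. u \<in> tangent_space M q \<and> v \<in> tangent_space M q} = UNIV"
        using assms(4) subsetD[OF VM q] unfolding cr_generic_def by (rule bspec)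
      ultimately show ?thesis
        by (rule T10_line[OF subspace_tangent[OF q] _ _ T10(1,2,3)[OF q]]) (rule exI)
    qed
    \<comment> \<open>Chosen pointwise, \<open>a\<close> carries no regularity yet; the next step
      supplies it.\<close>
    then obtain a where a: "\<And>q. q \<in> V \<Longrightarrow> L' q = cscale (a q) (L q)" by metis
    have C: "Ck_within 3 V a"
      by (rule Ck_within_T10_coefficient[OF tangent_fieldD(1)[OF field[OF gen]] T10(1,2)
          tangent_fieldD(1)[OF field[OF gen']] a])
    have "\<exists>A \<in> G_III2_initial. frame_III2 V L' p = frame_mult A (frame_III2 V L p)" if p: "p \<in> V" for p
    proof -
      have nz: "a p \<noteq> 0" using a[OF p] T10(4)[OF p] by auto
      obtain b c d e f g h k where eqs:
        "frame_III2 V L' p $ 3 = cscale b (L p) + cscale (cnj b) (cconj (L p)) + cscale (a p * cnj (a p)) (frame_III2 V L p $ 3)"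
        "frame_III2 V L' p $ 4 = cscale e (L p) + cscale d (cconj (L p)) + cscale c (frame_III2 V L p $ 3)
          + cscale (a p * a p * cnj (a p)) (frame_III2 V L p $ 4)"
        "frame_III2 V L' p $ 5 = cscale k (L p) + cscale h (cconj (L p)) + cscale g (frame_III2 V L p $ 3)
          + cscale f (frame_III2 V L p $ 4) + cscale (a p * a p * a p * cnj (a p)) (frame_III2 V L p $ 5)"
        using frame_transformation[OF field[OF gen] C a p]
        unfolding frame_III2_def Let_def vector_5 by blast
      let ?A = "vector [
        vector [a p, 0, 0, 0, 0],
        vector [0, cnj (a p), 0, 0, 0],
        vector [b, cnj b, a p * cnj (a p), 0, 0],
        vector [e, d, c, a p * a p * cnj (a p), 0],
        vector [k, h, g, f, a p * a p * a p * cnj (a p)]] :: complex ^ 5 ^ 5"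
      have F12: "frame_III2 V X p $ 1 = X p" "frame_III2 V X p $ 2 = cconj (X p)" for X
        by (simp_all add: frame_III2_def Let_def)
      have "frame_III2 V L' p = frame_mult ?A (frame_III2 V L p)"
        unfolding vec_eq_iff forall_5 eqs F12 a[OF p] cconj_cscale
        by (simp add: frame_mult_def sum_5 F12)
      moreover have "?A \<in> G_III2_initial" using nz by (simp add: mem_G_III2_initial_iff)
      ultimately show ?thesis by blast
    qed
    then show ?thesis by metis
  qed
  show ?thesis
    using basis reduction subgroup_G_III2_initial closedin_G_III2_initial submanifold_G_III2_initial
    unfolding performs_reduction_def by blast
qed

end
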